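(* Suppose $(A_t)_{0\le t\le1}$ is a path (continuous in $t$) of positive real $n\times n$ matrices which are all shift equivalent over $\mathbb R$ to one another. Then $A_0$ and $A_1$ are strong shift equivalent over $\mathbb R_+$.
   Context: A matrix is positive if all its entries are positive. $\mathbb R_+=[0,\infty)$. Square matrices $A,B$ are shift equivalent over $\mathbb R$ if there are real matrices $R,S$ and $\ell\in\mathbb N$ with $A^\ell=RS$, $B^\ell=SR$, $AR=RB$, $BS=SA$. Square matrices $A,B$ are strong shift equivalent over a semiring $\mathcal S$ if there are $\ell\in\mathbb N$, square matrices $A=A_0,A_1,\dots,A_\ell=B$ and (possibly rectangular) matrices $R_i,S_i$ over $\mathcal S$ with $A_{i-1}=R_iS_i$ and $A_i=S_iR_i$ for $1\le i\le\ell$ (these intermediate matrices are unrelated to the path). *)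

theory Defs
  imports "HOL-Analysis.Analysis" "Jordan_Normal_Form.Matrix"
begin

text \<open>
  A semiring such as \<open>{0..}\<close> is given by its underlying set \<open>\<S>\<close> of entries inside an ambient
  semiring type.  Multiplication of \<^typ>\<open>'a mat\<close> is total, so all dimensions are stated explicitly.
\<close>

definition mats_over :: "'a set \<Rightarrow> nat \<Rightarrow> nat \<Rightarrow> 'a mat set" where
  "mats_over \<S> n m = {M \<in> carrier_mat n m. elements_mat M \<subseteq> \<S>}"

definition positive_matrix :: "real mat \<Rightarrow> bool" where
  "positive_matrix A \<longleftrightarrow> (\<forall>i<dim_row A. \<forall>j<dim_col A. 0 < A $$ (i, j))"

text \<open>
  The lag \<open>l\<close> is taken to be at least \<open>1\<close>.  Lag \<open>0\<close> would add nothing: then \<open>R\<close> and \<open>S\<close> are mutually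
  inverse, and \<open>R\<close>, \<open>S * A\<close> is a shift equivalence of lag \<open>1\<close> from \<open>A\<close> to \<open>B\<close>.
\<close>

definition shift_equivalent_over :: "'a::semiring_1 set \<Rightarrow> 'a mat \<Rightarrow> 'a mat \<Rightarrow> bool" where
  "shift_equivalent_over \<S> A B \<longleftrightarrow>
    (\<exists>n m. A \<in> mats_over \<S> n n \<and> B \<in> mats_over \<S> m m \<and>
      (\<exists>R \<in> mats_over \<S> n m. \<exists>S \<in> mats_over \<S> m n. \<exists>l\<ge>1.
        A ^\<^sub>m l = R * S \<and> B ^\<^sub>m l = S * R \<and> A * R = R * B \<and> B * S = S * A))"

text \<open>
  \<open>C 0, \<dots>, C l\<close> is the chain of square matrices, \<open>C i\<close> being of size \<open>d i\<close>.  The length \<open>l\<close> is at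
  least \<open>1\<close>; the empty chain (\<open>A = B\<close>) is covered by \<open>A = A * 1\<close>, \<open>A = 1 * A\<close>.
\<close>

definition strong_shift_equivalent_over :: "'a::semiring_1 set \<Rightarrow> 'a mat \<Rightarrow> 'a mat \<Rightarrow> bool" where
  "strong_shift_equivalent_over \<S> A B \<longleftrightarrow>
    (\<exists>l\<ge>1. \<exists>(d :: nat \<Rightarrow> nat) (C :: nat \<Rightarrow> 'a mat) (R :: nat \<Rightarrow> 'a mat) (S :: nat \<Rightarrow> 'a mat).
      C 0 = A \<and> C l = B \<and>
      (\<forall>i\<le>l. C i \<in> mats_over \<S> (d i) (d i)) \<and>
      (\<forall>i\<in>{1..l}. R i \<in> mats_over \<S> (d (i - 1)) (d i) \<and> S i \<in> mats_over \<S> (d i) (d (i - 1)) \<and>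
         C (i - 1) = R i * S i \<and> C i = S i * R i))"

text \<open>
  There is no topology on \<^typ>\<open>real mat\<close>; for matrices of fixed size, continuity is continuity of
  all entries.
\<close>

definition matrix_path :: "nat \<Rightarrow> (real \<Rightarrow> real mat) \<Rightarrow> bool" where
  "matrix_path n A \<longleftrightarrow>
    (\<forall>t\<in>{0..1}. A t \<in> carrier_mat n n) \<and>
    (\<forall>i<n. \<forall>j<n. continuous_on {0..1} (\<lambda>t. A t $$ (i, j)))"

end

theory Submission
  imports Defs "Jordan_Normal_Form.Determinant"
begin

text \<open>
  Write \<open>\<sim>\<close> for strong shift equivalence over the nonnegative reals.
  Since \<open>[0, 1]\<close> is connected, it suffices that every \<open>t\<close> has a neighbourhood in which
  \<open>A s \<sim> A t\<close>.  If this failed at \<open>t\<close>, there would be a sequence \<open>a i = A (s i)\<close> with limit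
  \<open>L = A t\<close> and \<open>a i \<sim> L\<close> for no \<open>i\<close>; this is refuted with two kinds of moves.

  \<^item> Conjugation near the identity (\<open>eventually_sse_conjugate\<close>).  Conjugating a positive matrix by
    a matrix close to the identity stays within its class, although the conjugating matrix may have
    negative entries.
  \<^item> Nilpotent rank-one updates (\<open>sse_rank_one_update\<close>).  If \<open>A\<close> and \<open>A - x b\<close> are positive, \<open>x\<close> is a
    column killed by a power of \<open>A\<close>, and the row \<open>b\<close> kills \<open>x, A x, A\<^sup>2 x, \<dots>\<close>, then
    \<open>A \<sim> A - x b\<close>.  Such updates change the nilpotent part and hence the similarity class,
    which no conjugation can do; they need intermediate matrices of larger size.

  An orthogonal matrix \<open>Q i\<close> brings \<open>a i\<close> into the block form with a strictly upper triangular block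
  \<open>T i\<close>, above it on the right \<open>X i\<close>, and an invertible block \<open>H i\<close> at the bottom right
  (\<open>orthogonal_kernel_deflation\<close>).  Orthogonal matrices form a compact set, so along a subsequence
  the size of \<open>T i\<close> is constant and \<open>Q i\<close> converges, and the limit \<open>Q0\<close> brings \<open>L\<close> into the
  same form with blocks \<open>T\<close>, \<open>X\<close>, \<open>H\<close>.  Compactness is what makes the flags of the nilpotent parts
  converge although their Jordan types may jump.

  A shift equivalence between \<open>a i\<close> and \<open>L\<close> induces a similarity between \<open>H i\<close> and \<open>H\<close>, because it
  respects generalized kernels and the blocks are invertible
  (\<open>shift_equivalent_lower_blocks_similar\<close>).  Matrices that converge to \<open>H\<close> and are similar to it
  are conjugate to \<open>H\<close> by matrices \<open>G i\<close> converging to the identity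
  (\<open>similar_sequence_conjugators\<close>): the equations \<open>H i * G = G * H\<close> are linear in \<open>G\<close> and of rank
  independent of \<open>i\<close>, and so their solution spaces converge.

  Conjugating \<open>a i\<close> by \<open>Q i * diag(1, G i) * transpose Q0\<close>, which tends to the identity, replaces
  \<open>Q i\<close> by \<open>Q0\<close> and \<open>H i\<close> by \<open>H\<close>.  The result differs from \<open>L\<close> only in the rows of the nilpotent
  block, and only above the diagonal.  Replacing these rows one at a time consists of updates of the
  second kind (\<open>sse_row_updates\<close>), with all intermediate matrices close to \<open>L\<close> and hence positive.
\<close>

section \<open>Strong shift equivalence over the nonnegative reals\<close>

definition nonneg_matrix :: "real mat \<Rightarrow> bool" where
  "nonneg_matrix A \<longleftrightarrow> (\<forall>i<dim_row A. \<forall>j<dim_col A. 0 \<le> A $$ (i, j))"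

definition elementary_sse :: "real mat \<Rightarrow> real mat \<Rightarrow> bool" where
  "elementary_sse A B \<longleftrightarrow> (\<exists>R S. nonneg_matrix R \<and> nonneg_matrix S \<and>
     dim_row S = dim_col R \<and> dim_col S = dim_row R \<and> A = R * S \<and> B = S * R)"

abbreviation sse :: "real mat \<Rightarrow> real mat \<Rightarrow> bool" where
  "sse \<equiv> elementary_sse\<^sup>*\<^sup>*"

lemma elementary_sseI:
  assumes "nonneg_matrix R" "nonneg_matrix S" "dim_row S = dim_col R" "dim_col S = dim_row R"
  shows "elementary_sse (R * S) (S * R)"
  using assms unfolding elementary_sse_def by blast

lemma elementary_sse_sym: "elementary_sse A B \<Longrightarrow> elementary_sse B A"
  unfolding elementary_sse_def by metis

lemma sse_sym: "sse A B \<Longrightarrow> sse B A"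
  by (metis elementary_sse_sym symp_onI symp_rtranclp sympD)

lemma sse_trans: "sse A B \<Longrightarrow> sse B C \<Longrightarrow> sse A C"
  by (rule rtranclp_trans)

lemma positive_imp_nonneg_matrix: "positive_matrix A \<Longrightarrow> nonneg_matrix A"
  unfolding positive_matrix_def nonneg_matrix_def by (auto intro: less_imp_le)

lemma mats_over_nonneg_iff:
  "A \<in> mats_over {0..} n m \<longleftrightarrow> A \<in> carrier_mat n m \<and> nonneg_matrix A"
proof
  assume "A \<in> mats_over {0..} n m"
  then show "A \<in> carrier_mat n m \<and> nonneg_matrix A"
    unfolding mats_over_def nonneg_matrix_def
    by (force intro: elements_matI[of A n m])
next
  assume "A \<in> carrier_mat n m \<and> nonneg_matrix A"
  then show "A \<in> mats_over {0..} n m"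
    unfolding mats_over_def nonneg_matrix_def by (fastforce dest: elements_matD)
qed

lemma nonneg_matrix_mult:
  assumes "nonneg_matrix A" "nonneg_matrix B" "dim_col A = dim_row B"
  shows "nonneg_matrix (A * B)"
  using assms unfolding nonneg_matrix_def
  by (auto simp: scalar_prod_def intro!: sum_nonneg mult_nonneg_nonneg)

lemma sse_imp_strong_shift_equivalent_over:
  assumes "sse A B" "nonneg_matrix A" "A \<in> carrier_mat n n"
  shows "strong_shift_equivalent_over {0..} A B"
  using assms(1)
proof (induction rule: rtranclp_induct)
  case base
  have one: "(1\<^sub>m n :: real mat) \<in> mats_over {0..} n n"
    by (auto simp: mats_over_nonneg_iff nonneg_matrix_def)
  show ?case unfolding strong_shift_equivalent_over_def
    by (rule exI[of _ 1], rule conjI, simp, rule exI[of _ "\<lambda>_. n"], rule exI[of _ "\<lambda>_. A"],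
        rule exI[of _ "\<lambda>_. A"], rule exI[of _ "\<lambda>_. 1\<^sub>m n"])
      (use one assms in \<open>auto simp: mats_over_nonneg_iff\<close>)
next
  case (step B C)
  from step(3) obtain l :: nat and d M R S where l: "l \<ge> 1" and M0: "M 0 = A" and Ml: "M l = B"
    and M: "\<And>i. i \<le> l \<Longrightarrow> M i \<in> mats_over {0..} (d i) (d i)"
    and RS: "\<And>i. i \<in> {1..l} \<Longrightarrow> R i \<in> mats_over {0..} (d (i - 1)) (d i) \<and>
         S i \<in> mats_over {0..} (d i) (d (i - 1)) \<and> M (i - 1) = R i * S i \<and> M i = S i * R i"
    unfolding strong_shift_equivalent_over_def
    by blast
  from step(2) obtain R' S' where R': "nonneg_matrix R'" "nonneg_matrix S'"
     "dim_row S' = dim_col R'" "dim_col S' = dim_row R'" "B = R' * S'" "C = S' * R'"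
    unfolding elementary_sse_def by blast
  have dl: "d l = dim_row R'"
    using M[of l] R'(5) Ml by (auto simp: mats_over_nonneg_iff)
  define d' where "d' = d(Suc l := dim_col R')"
  have C: "C \<in> mats_over {0..} (dim_col R') (dim_col R')"
    using R' by (auto simp: mats_over_nonneg_iff intro: nonneg_matrix_mult)
  show ?case unfolding strong_shift_equivalent_over_def
  proof (rule exI[of _ "Suc l"], rule conjI, simp, rule exI[of _ d'], rule exI[of _ "M(Suc l := C)"],
      rule exI[of _ "R(Suc l := R')"], rule exI[of _ "S(Suc l := S')"], intro conjI allI impI ballI)
    fix i assume "i \<le> Suc l"
    then show "(M(Suc l := C)) i \<in> mats_over {0..} (d' i) (d' i)"
      using M[of i] C by (auto simp: d'_def)
  next
    fix i assume i: "i \<in> {1..Suc l}"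
    consider "i = Suc l" | "i \<in> {1..l}" "i \<noteq> Suc l" "i - 1 \<noteq> Suc l" using i by force
    note c = this
    show "(R(Suc l := R')) i \<in> mats_over {0..} (d' (i - 1)) (d' i)"
      using c RS[of i] R' dl by cases (auto simp: d'_def mats_over_nonneg_iff)
    show "(S(Suc l := S')) i \<in> mats_over {0..} (d' i) (d' (i - 1))"
      using c RS[of i] R' dl by cases (auto simp: d'_def mats_over_nonneg_iff)
    show "(M(Suc l := C)) (i - 1) = (R(Suc l := R')) i * (S(Suc l := S')) i"
      using c RS[of i] R' dl Ml by cases (auto simp: d'_def)
    show "(M(Suc l := C)) i = (S(Suc l := S')) i * (R(Suc l := R')) i"
      using c RS[of i] R' dl Ml by cases (auto simp: d'_def)
  qed (use l M0 in auto)
qed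

text \<open>
  With dimensions instead of carrier sets as side conditions, all variables occur in the equation and
  the simplifier can use it as a rewrite rule.
\<close>

lemma mult_mat_assoc:
  fixes A :: "'a::semiring_0 mat"
  shows "dim_col A = dim_row B \<Longrightarrow> dim_col B = dim_row C \<Longrightarrow> (A * B) * C = A * (B * C)"
  by (rule assoc_mult_mat) (auto intro: carrier_matI)

lemma mult_mat_cancel:
  fixes A :: "'a::semiring_1 mat"
  assumes "A * B = 1\<^sub>m n" "dim_col A = dim_row B" "dim_col B = n" "dim_row C = n"
  shows "A * (B * C) = C"
proof -
  have "A * (B * C) = 1\<^sub>m n * C"
    using assms by (simp flip: mult_mat_assoc)
  then show ?thesis using assms(4) by simp
qed

lemma index_mult_mat_sum:
  "i < dim_row A \<Longrightarrow> j < dim_col B \<Longrightarrow> dim_col A = dim_row B \<Longrightarrow>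
    (A * B) $$ (i, j) = (\<Sum>k<dim_row B. A $$ (i, k) * B $$ (k, j))"
  by (simp add: scalar_prod_def atLeast0LessThan)

section \<open>Entrywise limits of matrices\<close>

definition mat_tendsto :: "(nat \<Rightarrow> real mat) \<Rightarrow> real mat \<Rightarrow> bool" where
  "mat_tendsto X L \<longleftrightarrow> (\<forall>i. dim_row (X i) = dim_row L \<and> dim_col (X i) = dim_col L) \<and>
     (\<forall>a<dim_row L. \<forall>b<dim_col L. (\<lambda>i. X i $$ (a, b)) \<longlonglongrightarrow> L $$ (a, b))"

lemma mat_tendsto_dim:
  assumes "mat_tendsto X L"
  shows "dim_row (X i) = dim_row L" "dim_col (X i) = dim_col L"
  using assms unfolding mat_tendsto_def by auto

lemma mat_tendsto_const: "mat_tendsto (\<lambda>_. L) L"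
  unfolding mat_tendsto_def by simp

lemma mat_tendsto_unique:
  assumes "mat_tendsto X L" "mat_tendsto X M"
  shows "L = M"
proof -
  have d: "dim_row L = dim_row M" "dim_col L = dim_col M"
    using mat_tendsto_dim[OF assms(1), of 0] mat_tendsto_dim[OF assms(2), of 0] by auto
  show ?thesis
  proof (rule eq_matI)
    fix i j assume ij: "i < dim_row M" "j < dim_col M"
    then show "L $$ (i, j) = M $$ (i, j)"
      using assms d LIMSEQ_unique[of "\<lambda>m. X m $$ (i, j)"] unfolding mat_tendsto_def by simp
  qed (use d in auto)
qed

lemma mat_tendsto_mult:
  assumes "mat_tendsto X L" "mat_tendsto Y M" "dim_col L = dim_row M"
  shows "mat_tendsto (\<lambda>i. X i * Y i) (L * M)"
  using assms unfolding mat_tendsto_def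
  by (auto simp: index_mult_mat_sum simp del: index_mult_mat(1) intro!: tendsto_sum tendsto_mult)

lemma mat_tendsto_minus:
  assumes "mat_tendsto X L" "mat_tendsto Y M" "dim_row L = dim_row M" "dim_col L = dim_col M"
  shows "mat_tendsto (\<lambda>i. X i - Y i) (L - M)"
  using assms unfolding mat_tendsto_def by (auto intro!: tendsto_diff)

lemma mat_tendsto_transpose:
  assumes "mat_tendsto X L"
  shows "mat_tendsto (\<lambda>i. transpose_mat (X i)) (transpose_mat L)"
  using assms unfolding mat_tendsto_def by auto

lemma mat_tendsto_subseq:
  assumes "mat_tendsto X L" "strict_mono r"
  shows "mat_tendsto (\<lambda>i. X (r i)) L"
  using assms LIMSEQ_subseq_LIMSEQ unfolding mat_tendsto_def comp_def by blast

lemma eventually_positive_matrix: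
  assumes "mat_tendsto X L" "positive_matrix L"
  shows "\<forall>\<^sub>F i in sequentially. positive_matrix (X i)"
proof -
  have "\<forall>\<^sub>F i in sequentially. \<forall>a\<in>{..<dim_row L}. \<forall>b\<in>{..<dim_col L}. 0 < X i $$ (a, b)"
    using assms unfolding mat_tendsto_def positive_matrix_def
    by (intro eventually_ball_finite ballI order_tendstoD(1)[where a=0]) auto
  then show ?thesis
    by eventually_elim (use mat_tendsto_dim[OF assms(1)] in \<open>auto simp: positive_matrix_def\<close>)
qed

lemma det_tendsto:
  assumes X: "mat_tendsto X L" and sq: "dim_row L = dim_col L"
  shows "(\<lambda>i. Determinant.det (X i)) \<longlonglongrightarrow> Determinant.det L"
proof -
  define n where "n = dim_row L"
  have L: "L \<in> carrier_mat n n" and Xi: "X i \<in> carrier_mat n n" for i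
    using sq mat_tendsto_dim[OF X] n_def by auto
  have "(\<lambda>i. X i $$ (a, p a)) \<longlonglongrightarrow> L $$ (a, p a)" if "p permutes {0..<n}" "a < n" for p a
    using X permutes_in_image[OF that(1), of a] that(2) L unfolding mat_tendsto_def by auto
  then show ?thesis
    unfolding det_def'[OF L] det_def'[OF Xi]
    by (intro tendsto_sum tendsto_mult tendsto_const tendsto_prod) auto
qed

text \<open>
  The entries of the adjugate and the determinant are polynomials in the entries of the matrix, so
  \<open>adj / det\<close> converges along with the matrix.
\<close>

lemma inverse_tendsto_one:
  assumes X: "mat_tendsto X (1\<^sub>m n)"
  obtains Y where "mat_tendsto Y (1\<^sub>m n)"
    "\<forall>\<^sub>F i in sequentially. X i * Y i = 1\<^sub>m n \<and> Y i * X i = 1\<^sub>m n"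
proof
  define Y where "Y i = (1 / Determinant.det (X i)) \<cdot>\<^sub>m adj_mat (X i)" for i
  have Xi: "X i \<in> carrier_mat n n" for i
    using mat_tendsto_dim[OF X] by auto
  have d: "(\<lambda>i. Determinant.det (X i)) \<longlonglongrightarrow> 1"
    using det_tendsto[OF X] by simp
  have adj1: "adj_mat (1\<^sub>m n) = (1\<^sub>m n :: real mat)"
    using adj_mat(1,2)[of "1\<^sub>m n :: real mat" n] by (auto simp: left_mult_one_mat)
  have del: "mat_tendsto (\<lambda>i. mat_delete (X i) a b) (mat_delete (1\<^sub>m n) a b)" if "a < n" "b < n" for a b
    unfolding mat_tendsto_def
  proof (intro conjI allI impI)
    fix c d assume "c < dim_row (mat_delete (1\<^sub>m n :: real mat) a b)" "d < dim_col (mat_delete (1\<^sub>m n :: real mat) a b)"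
    then have cd: "c < n - 1" "d < n - 1" by (auto simp: mat_delete_def)
    have "(\<lambda>i. X i $$ (insert_index a c, insert_index b d)) \<longlonglongrightarrow> 1\<^sub>m n $$ (insert_index a c, insert_index b d)"
      using X cd unfolding mat_tendsto_def by (simp add: insert_index_def del: index_one_mat(1))
    then show "(\<lambda>i. mat_delete (X i) a b $$ (c, d)) \<longlonglongrightarrow> mat_delete (1\<^sub>m n) a b $$ (c, d)"
      using cd that mat_tendsto_dim[OF X] by (simp add: mat_delete_def insert_index_def)
  qed (use mat_tendsto_dim[OF X] in \<open>auto simp: mat_delete_def\<close>)
  have adj: "mat_tendsto (\<lambda>i. adj_mat (X i)) (adj_mat (1\<^sub>m n))"
    unfolding mat_tendsto_def
  proof (intro conjI allI impI)
    fix a b assume ab: "a < dim_row (adj_mat (1\<^sub>m n :: real mat))" "b < dim_col (adj_mat (1\<^sub>m n :: real mat))"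
    then have ab: "a < n" "b < n" by (auto simp: adj_mat_def)
    show "(\<lambda>i. adj_mat (X i) $$ (a, b)) \<longlonglongrightarrow> adj_mat (1\<^sub>m n) $$ (a, b)"
      using ab Xi[THEN carrier_matD(1)] Xi[THEN carrier_matD(2)] det_tendsto[OF del[OF ab(2,1)]]
      by (auto simp: adj_mat_def cofactor_def mat_delete_def intro!: tendsto_mult)
  qed (use Xi[THEN carrier_matD(1)] Xi[THEN carrier_matD(2)] in \<open>auto simp: adj_mat_def\<close>)
  have di: "(\<lambda>i. 1 / Determinant.det (X i)) \<longlonglongrightarrow> 1"
    using tendsto_divide[OF tendsto_const d, of 1] by simp
  show "mat_tendsto Y (1\<^sub>m n)"
    unfolding mat_tendsto_def
  proof (intro conjI allI impI)
    fix a b assume "a < dim_row (1\<^sub>m n :: real mat)" "b < dim_col (1\<^sub>m n :: real mat)"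
    then have ab: "a < n" "b < n" by auto
    have "(\<lambda>i. 1 / Determinant.det (X i) * adj_mat (X i) $$ (a, b)) \<longlonglongrightarrow> 1 * 1\<^sub>m n $$ (a, b)"
      using ab by (intro tendsto_mult di adj[unfolded adj1 mat_tendsto_def, THEN conjunct2, rule_format]) auto
    then show "(\<lambda>i. Y i $$ (a, b)) \<longlonglongrightarrow> 1\<^sub>m n $$ (a, b)"
      using ab adj_mat(1)[OF Xi, THEN carrier_matD(1)] adj_mat(1)[OF Xi, THEN carrier_matD(2)]
      by (simp add: Y_def)
  qed (use adj_mat(1)[OF Xi] in \<open>auto simp: Y_def\<close>)
  have "\<forall>\<^sub>F i in sequentially. Determinant.det (X i) \<noteq> 0"
    using tendsto_imp_eventually_ne[OF d] by simp
  then show "\<forall>\<^sub>F i in sequentially. X i * Y i = 1\<^sub>m n \<and> Y i * X i = 1\<^sub>m n"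
  proof eventually_elim
    case (elim i)
    have "X i * Y i = (1 / Determinant.det (X i)) \<cdot>\<^sub>m (X i * adj_mat (X i))"
      unfolding Y_def using mult_smult_distrib[OF Xi adj_mat(1)[OF Xi]] by simp
    moreover have "Y i * X i = (1 / Determinant.det (X i)) \<cdot>\<^sub>m (adj_mat (X i) * X i)"
      unfolding Y_def using mult_smult_assoc_mat[OF adj_mat(1)[OF Xi] Xi] by simp
    ultimately show ?case using elim adj_mat(2,3)[OF Xi] by auto
  qed
qed

section \<open>Conjugation by matrices near the identity\<close>

text \<open>
  Neither \<open>G i\<close> nor \<open>G' i\<close> need be nonnegative, so \<open>X i = G i * (G' i * X i)\<close> is not a
  factorization of the required kind.  With \<open>J\<close> the all-ones matrix and \<open>F = 1 + c J\<close>, the remedy is a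
  detour through \<open>F * X i * F\<inverse>\<close>: the first step has the factor \<open>F\<close>, the second the factor
  \<open>F * G i\<close>, which tends to \<open>F\<close>, and the entries of \<open>F\<close> are at least \<open>c > 0\<close>.  The complementary
  factors \<open>X i * F\<inverse>\<close> and \<open>G' i * X i * F\<inverse>\<close> both tend to \<open>L * F\<inverse>\<close>, which is positive for
  small \<open>c\<close> because \<open>L\<close> is; here \<open>F\<inverse> = 1 - d J\<close> with \<open>d = c / (1 + c n)\<close>, because \<open>J\<^sup>2 = n J\<close>.
\<close>

lemma eventually_sse_conjugate:
  assumes X: "mat_tendsto X L" and L: "L \<in> carrier_mat n n" "positive_matrix L"
    and G: "mat_tendsto G (1\<^sub>m n)" and G': "mat_tendsto G' (1\<^sub>m n)"
    and inv: "\<forall>\<^sub>F i in sequentially. G i * G' i = 1\<^sub>m n"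
  shows "\<forall>\<^sub>F i in sequentially. sse (X i) (G' i * X i * G i)"
proof -
  have "\<forall>\<^sub>F c :: real in at_right 0. \<forall>i\<in>{..<n}. \<forall>j\<in>{..<n}. 
      0 < L $$ (i, j) - (c / (1 + c * n)) * (\<Sum>k<n. L $$ (i, k))"
  proof (intro eventually_ball_finite ballI order_tendstoD(1)[where a=0])
    fix i j assume ij: "i \<in> {..<n}" "j \<in> {..<n}"
    show "((\<lambda>c :: real. L $$ (i, j) - (c / (1 + c * n)) * (\<Sum>k<n. L $$ (i, k))) \<longlongrightarrow> L $$ (i, j)) (at_right 0)"
      by (auto intro!: tendsto_eq_intros)
    show "0 < L $$ (i, j)" using L ij by (auto simp: positive_matrix_def)
  qed auto
  then have "\<forall>\<^sub>F c :: real in at_right 0. (\<forall>i\<in>{..<n}. \<forall>j\<in>{..<n}. 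
      0 < L $$ (i, j) - (c / (1 + c * n)) * (\<Sum>k<n. L $$ (i, k))) \<and> 0 < c"
    by (intro eventually_conj eventually_at_right_less)
  from eventually_happens'[OF trivial_limit_at_right_real this] obtain c :: real where c: "0 < c" and 
    Lc: "\<And>i j. i < n \<Longrightarrow> j < n \<Longrightarrow> 0 < L $$ (i, j) - (c / (1 + c * n)) * (\<Sum>k<n. L $$ (i, k))"
    by auto
  \<comment> \<open>The constant that makes \<open>1 - d J\<close> inverse to \<open>1 + c J\<close>.\<close>
  define d where "d = c / (1 + c * n)"
  have "1 + c * n > 0" using c by (simp add: add_pos_nonneg)
  then have dc: "c - d - n * c * d = 0" unfolding d_def by (simp add: field_simps)
  define F where "F = mat n n (\<lambda>(i, j). (if i = j then 1 else 0) + c)"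
  define F' where "F' = mat n n (\<lambda>(i, j). (if i = j then 1 else 0) - d)"
  have [simp]: "dim_row F = n" "dim_col F = n" "dim_row F' = n" "dim_col F' = n"
    by (auto simp: F_def F'_def)
  have FF': "F * F' = 1\<^sub>m n"
  proof (rule eq_matI)
    fix i j assume "i < dim_row (1\<^sub>m n :: real mat)" "j < dim_col (1\<^sub>m n :: real mat)"
    then have ij: "i < n" "j < n" by auto
    have "(F * F') $$ (i, j) = (\<Sum>k<n. ((if i = k then 1 else 0) + c) * ((if k = j then 1 else 0) - d))"
      using ij by (subst index_mult_mat_sum) (auto simp: F_def F'_def)
    also have "\<dots> = (\<Sum>k<n. (if k = i then (if k = j then 1 else 0) else 0) + (if k = j then c else 0)
          - (if k = i then d else 0) - c * d)"
      by (intro sum.cong) (auto simp: algebra_simps)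
    also have "\<dots> = (if i = j then 1 else 0) + (c - d - n * c * d)"
      using ij by (simp add: sum.distrib sum_subtractf sum.delta)
    also have "\<dots> = (if i = j then 1 else 0)" by (simp add: dc)
    finally show "(F * F') $$ (i, j) = 1\<^sub>m n $$ (i, j)" using ij by simp
  qed auto
  then have F'F: "F' * F = 1\<^sub>m n"
    by (intro mat_mult_left_right_inverse[of F n F']) (auto intro: carrier_matI)
  have dims [simp]: "dim_row L = n" "dim_col L = n" "dim_row (X i) = n" "dim_col (X i) = n"
    "dim_row (G i) = n" "dim_col (G i) = n" "dim_row (G' i) = n" "dim_col (G' i) = n" for i
    using L mat_tendsto_dim[OF X] mat_tendsto_dim[OF G] mat_tendsto_dim[OF G'] by auto
  have pos1: "positive_matrix (L * F')"
    unfolding positive_matrix_def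
  proof (intro allI impI)
    fix i j assume "i < dim_row (L * F')" "j < dim_col (L * F')"
    then have ij: "i < n" "j < n" by auto
    have "(L * F') $$ (i, j) = (\<Sum>k<n. (if k = j then L $$ (i, k) else 0) - d * L $$ (i, k))"
      using ij by (subst index_mult_mat_sum) (auto simp: F'_def algebra_simps intro!: sum.cong)
    also have "\<dots> = L $$ (i, j) - d * (\<Sum>k<n. L $$ (i, k))"
      using ij by (simp add: sum_subtractf sum_distrib_left)
    finally show "0 < (L * F') $$ (i, j)" using Lc[OF ij] by (simp add: d_def)
  qed
  have pos2: "positive_matrix F" using c by (auto simp: positive_matrix_def F_def)
  have t1: "mat_tendsto (\<lambda>i. X i * F') (L * F')"
    by (intro mat_tendsto_mult X mat_tendsto_const) simp
  have "mat_tendsto (\<lambda>i. F * G i) (F * 1\<^sub>m n)" "mat_tendsto (\<lambda>i. G' i * (X i * F')) (1\<^sub>m n * (L * F'))"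
    by (intro mat_tendsto_mult X mat_tendsto_const G G' t1, simp)+
  then have t2: "mat_tendsto (\<lambda>i. F * G i) F" and t3: "mat_tendsto (\<lambda>i. G' i * (X i * F')) (L * F')"
    by (simp_all add: right_mult_one_mat' left_mult_one_mat')
  show ?thesis
    using eventually_positive_matrix[OF t1 pos1] eventually_positive_matrix[OF t2 pos2]
      eventually_positive_matrix[OF t3 pos1] inv
  proof eventually_elim
    case (elim i)
    have "elementary_sse (X i * F' * F) (F * (X i * F'))"
      using elim pos2 by (intro elementary_sseI positive_imp_nonneg_matrix) auto
    moreover have "elementary_sse (F * G i * (G' i * (X i * F'))) (G' i * (X i * F') * (F * G i))"
      using elim pos2 by (intro elementary_sseI positive_imp_nonneg_matrix) auto
    moreover have "X i * F' * F = X i"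
      by (simp add: mult_mat_assoc F'F right_mult_one_mat')
    moreover have "F * G i * (G' i * (X i * F')) = F * (X i * F')"
      by (simp add: mult_mat_assoc mult_mat_cancel[OF elim(4)])
    moreover have "G' i * (X i * F') * (F * G i) = G' i * X i * G i"
      by (simp add: mult_mat_assoc mult_mat_cancel[OF F'F])
    ultimately show ?case by (metis converse_rtranclp_into_rtranclp r_into_rtranclp)
  qed
qed

section \<open>Nilpotent rank-one updates\<close>

abbreviation fun_mat :: "nat \<Rightarrow> (nat \<Rightarrow> nat \<Rightarrow> real) \<Rightarrow> real mat" where
  "fun_mat n f \<equiv> mat n n (\<lambda>(i, j). f i j)"

text \<open>
  Adding a row and a column.  The two matrices are \<open>R * S\<close> and \<open>S * R\<close> for the block matrices
  \<open>R = [1, y]\<close> and \<open>S\<close> with \<open>C\<close> on top of \<open>b\<close>.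
\<close>

lemma sse_border:
  fixes C :: "nat \<Rightarrow> nat \<Rightarrow> real" and y b :: "nat \<Rightarrow> real"
  assumes "\<And>i j. i < n \<Longrightarrow> j < n \<Longrightarrow> 0 \<le> C i j" "\<And>i. i < n \<Longrightarrow> 0 \<le> y i" "\<And>i. i < n \<Longrightarrow> 0 \<le> b i"
  shows "elementary_sse (fun_mat n (\<lambda>i j. C i j + y i * b j))
     (fun_mat (Suc n) (\<lambda>i j. if i < n then (if j < n then C i j else \<Sum>l<n. C i l * y l)
        else (if j < n then b j else \<Sum>l<n. b l * y l)))" (is "elementary_sse ?A ?B")
proof -
  define R where "R = mat n (Suc n) (\<lambda>(i, j). if j < n then (if i = j then 1 else 0) else y i)"
  define S where "S = mat (Suc n) n (\<lambda>(i, j). if i < n then C i j else b j)"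
  have "elementary_sse (R * S) (S * R)"
    using assms by (intro elementary_sseI) (auto simp: R_def S_def nonneg_matrix_def)
  moreover have "R * S = ?A"
  proof (rule eq_matI)
    fix i j assume "i < dim_row ?A" "j < dim_col ?A"
    then have ij: "i < n" "j < n" by auto
    have "(R * S) $$ (i, j) = (\<Sum>k<n. (if i = k then 1 else 0) * C k j) + y i * b j"
      using ij by (subst index_mult_mat_sum) (auto simp: R_def S_def)
    also have "\<dots> = C i j + y i * b j"
      using ij by (simp add: if_distrib[of "\<lambda>c. c * _"] sum.delta cong: if_cong)
    finally show "(R * S) $$ (i, j) = ?A $$ (i, j)" using ij by simp
  qed (auto simp: R_def S_def)
  moreover have "S * R = ?B"
  proof (rule eq_matI)
    fix i j assume "i < dim_row ?B" "j < dim_col ?B"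
    then have ij: "i < Suc n" "j < Suc n" by auto
    have *: "(S * R) $$ (i, j) = (\<Sum>k<n. (if i < n then C i k else b k) * 
       (if j < n then (if k = j then 1 else 0) else y k))"
      using ij by (subst index_mult_mat_sum) (auto simp: R_def S_def)
    show "(S * R) $$ (i, j) = ?B $$ (i, j)"
      using ij unfolding * by (auto simp: if_distrib[of "\<lambda>c. _ * c"] sum.delta cong: if_cong)
  qed (auto simp: R_def S_def)
  ultimately show ?thesis by simp
qed

text \<open>
  The heart of the argument: if rank-one updates along chains of length \<open>m\<close> are possible, then so are
  those along chains \<open>z 0, z 1 = B (z 0), \<dots>\<close> of length \<open>m + 1\<close>, provided that the row \<open>c\<close> is positive.
  Choose positive columns \<open>y\<close>, \<open>y'\<close> with \<open>y' - y = z 0\<close> such that \<open>C = B - y' c\<close> is still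
  positive.  Then \<open>B = C + y' c\<close> and \<open>B - z 0 c = C + y c\<close> can be enlarged by \<open>sse_border\<close> with the same
  \<open>C\<close> and \<open>c\<close>.  The enlarged matrices agree but for the last column, where they differ by
  \<open>C (z 0) = B (z 0) = z 1\<close>.  So they are related by an update along the shorter chain \<open>z 1, z 2, \<dots>\<close>.
  There the row is a unit vector, which is why the shorter updates must be available for rows that are
  not positive.
\<close>

lemma sse_chain_update_pos:
  fixes B :: "nat \<Rightarrow> nat \<Rightarrow> real" and z :: "nat \<Rightarrow> nat \<Rightarrow> real" and c :: "nat \<Rightarrow> real"
  assumes IH: "\<And>n A x b. \<lbrakk>\<And>i j. i < n \<Longrightarrow> j < n \<Longrightarrow> 0 < A i j;
       \<And>i j. i < n \<Longrightarrow> j < n \<Longrightarrow> 0 < A i j - x 0 i * b j;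
       \<And>k i. i < n \<Longrightarrow> x (Suc k) i = (\<Sum>j<n. A i j * x k j);
       \<And>k. (\<Sum>j<n. b j * x k j) = 0; \<And>i. i < n \<Longrightarrow> x m i = 0\<rbrakk>
     \<Longrightarrow> sse (fun_mat n A) (fun_mat n (\<lambda>i j. A i j - x 0 i * b j))"
  assumes B: "\<And>i j. i < n \<Longrightarrow> j < n \<Longrightarrow> 0 < B i j"
    and B': "\<And>i j. i < n \<Longrightarrow> j < n \<Longrightarrow> 0 < B i j - z 0 i * c j"
    and z: "\<And>k i. i < n \<Longrightarrow> z (Suc k) i = (\<Sum>j<n. B i j * z k j)"
    and cz: "\<And>k. (\<Sum>j<n. c j * z k j) = 0"
    and zm: "\<And>i. i < n \<Longrightarrow> z (Suc m) i = 0"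
    and c: "\<And>j. j < n \<Longrightarrow> 0 < c j"
  shows "sse (fun_mat n B) (fun_mat n (\<lambda>i j. B i j - z 0 i * c j))"
proof (cases "n = 0")
  case True
  then have "fun_mat n B = fun_mat n (\<lambda>i j. B i j - z 0 i * c j)" by (intro eq_matI) auto
  then show ?thesis by simp
next
  case False
  then have n: "0 < n" by simp
  have "\<forall>\<^sub>F \<eta> in at_right 0. (\<forall>i\<in>{..<n}. \<forall>j\<in>{..<n}. 0 < B i j - (max 0 (z 0 i) + \<eta>) * c j)"
  proof (intro eventually_ball_finite ballI order_tendstoD(1)[where a=0])
    fix i j assume ij: "i \<in> {..<n}" "j \<in> {..<n}"
    show "((\<lambda>\<eta>. B i j - (max 0 (z 0 i) + \<eta>) * c j) \<longlongrightarrow> B i j - (max 0 (z 0 i) + 0) * c j) (at_right 0)"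
      by (intro tendsto_intros)
    show "0 < B i j - (max 0 (z 0 i) + 0) * c j"
      using B[of i j] B'[of i j] ij by (auto simp: max_def)
  qed auto
  then have "\<forall>\<^sub>F \<eta> in at_right 0. (\<forall>i\<in>{..<n}. \<forall>j\<in>{..<n}. 0 < B i j - (max 0 (z 0 i) + \<eta>) * c j) \<and> 0 < \<eta>"
    by (intro eventually_conj eventually_at_right_less)
  from eventually_happens'[OF trivial_limit_at_right_real this] obtain \<eta> :: real where eta: "0 < \<eta>" and
    pos: "\<And>i j. i < n \<Longrightarrow> j < n \<Longrightarrow> 0 < B i j - (max 0 (z 0 i) + \<eta>) * c j"
    by auto
  \<comment> \<open>Negative and positive part of \<open>z 0\<close>, made strictly positive; \<open>B - y' c\<close> is positive because both \<open>B\<close> and \<open>B - z 0 c\<close> are.\<close>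
  define y where "y i = max 0 (- z 0 i) + \<eta>" for i
  define y' where "y' i = max 0 (z 0 i) + \<eta>" for i
  have yy: "y' i = y i + z 0 i" for i by (auto simp: y_def y'_def)
  have ypos: "0 < y i" "0 < y' i" for i using eta by (auto simp: y_def y'_def)
  define C where "C i j = B i j - y' i * c j" for i j
  have C: "0 < C i j" if "i < n" "j < n" for i j using pos[OF that] by (simp add: C_def y'_def)
  have Cz: "(\<Sum>j<n. C i j * z k j) = z (Suc k) i" if "i < n" for i k
  proof -
    have "(\<Sum>j<n. C i j * z k j) = (\<Sum>j<n. B i j * z k j) - y' i * (\<Sum>j<n. c j * z k j)"
      by (simp add: C_def algebra_simps sum_subtractf sum_distrib_left)
    then show ?thesis using z[OF that] cz by simp
  qed
  define E where "E w = (\<lambda>i j. if i < n then (if j < n then C i j else \<Sum>l<n. C i l * w l)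
        else (if j < n then c j else \<Sum>l<n. c l * w l))" for w :: "nat \<Rightarrow> real"
  have Epos: "0 < E w i j" if "\<And>i. 0 < w i" for w i j
    unfolding E_def using that C c n by (auto intro!: sum_pos mult_pos_pos)
  have "elementary_sse (fun_mat n (\<lambda>i j. C i j + y' i * c j)) (fun_mat (Suc n) (E y'))"
    unfolding E_def using C c ypos by (intro sse_border) (auto intro: less_imp_le)
  moreover have "fun_mat n (\<lambda>i j. C i j + y' i * c j) = fun_mat n B"
    by (simp add: C_def)
  ultimately have 1: "sse (fun_mat n B) (fun_mat (Suc n) (E y'))" by auto
  have "elementary_sse (fun_mat n (\<lambda>i j. C i j + y i * c j)) (fun_mat (Suc n) (E y))"
    unfolding E_def using C c ypos by (intro sse_border) (auto intro: less_imp_le)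
  moreover have "fun_mat n (\<lambda>i j. C i j + y i * c j) = fun_mat n (\<lambda>i j. B i j - z 0 i * c j)"
    by (simp add: C_def yy algebra_simps)
  ultimately have 2: "sse (fun_mat (Suc n) (E y)) (fun_mat n (\<lambda>i j. B i j - z 0 i * c j))"
    by (auto intro: sse_sym)
  define x where "x k i = (if i < n then z (Suc k) i else 0)" for k i
  \<comment> \<open>The last unit row, which picks out the column in which the enlarged matrices differ.\<close>
  define f :: "nat \<Rightarrow> real" where "f j = (if j < n then 0 else 1)" for j
  have E: "E y' i j - x 0 i * f j = E y i j" if "i < Suc n" "j < Suc n" for i j
  proof -
    have "(\<Sum>l<n. C i l * y' l) = (\<Sum>l<n. C i l * y l) + z 1 i" if "i < n"
      using Cz[OF that, of 0] by (simp add: yy algebra_simps sum.distrib)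
    moreover have "(\<Sum>l<n. c l * y' l) = (\<Sum>l<n. c l * y l)"
      using cz[of 0] by (simp add: yy algebra_simps sum.distrib)
    ultimately show ?thesis using that by (auto simp: E_def x_def f_def)
  qed
  have 3: "sse (fun_mat (Suc n) (E y')) (fun_mat (Suc n) (\<lambda>i j. E y' i j - x 0 i * f j))"
  proof (rule IH)
    show "0 < E y' i j" for i j by (rule Epos) (rule ypos)
    show "0 < E y' i j - x 0 i * f j" if "i < Suc n" "j < Suc n" for i j
      unfolding E[OF that] by (rule Epos) (rule ypos)
    show "x (Suc k) i = (\<Sum>j<Suc n. E y' i j * x k j)" for k i
      using Cz[of i "Suc k"] cz[of "Suc k"] by (simp add: x_def E_def)
    show "(\<Sum>j<Suc n. f j * x k j) = 0" for k by (simp add: x_def f_def)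
    show "x m i = 0" for i using zm by (simp add: x_def)
  qed
  have 4: "fun_mat (Suc n) (\<lambda>i j. E y' i j - x 0 i * f j) = fun_mat (Suc n) (E y)"
    by (rule eq_matI) (auto simp: E)
  show ?thesis by (rule sse_trans[OF sse_trans[OF 1 3[unfolded 4]] 2])
qed

text \<open>
  Rank-one updates for arbitrary rows \<open>b\<close>, by induction on the length of the chain.  Let \<open>q\<close> be the
  sum of the rows of the power of \<open>A\<close> that kills \<open>x 0\<close>.  It is positive since \<open>A\<close> is, and it kills
  the chain.  Hence \<open>x b = x (b + K q) - x (K q)\<close> is a difference of two updates with positive rows
  when \<open>K\<close> is large.  Performing one and then the other might lead out of the positive matrices, so
  both are cut into \<open>N\<close> small portions that are performed alternately: the matrices then stay close
  to the segment from \<open>A\<close> to \<open>A - x b\<close>, all of which is positive.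
\<close>

lemma sse_chain_update:
  fixes A :: "nat \<Rightarrow> nat \<Rightarrow> real" and x :: "nat \<Rightarrow> nat \<Rightarrow> real" and b :: "nat \<Rightarrow> real"
  assumes "\<And>i j. i < n \<Longrightarrow> j < n \<Longrightarrow> 0 < A i j"
    and "\<And>i j. i < n \<Longrightarrow> j < n \<Longrightarrow> 0 < A i j - x 0 i * b j"
    and "\<And>k i. i < n \<Longrightarrow> x (Suc k) i = (\<Sum>j<n. A i j * x k j)"
    and "\<And>k. (\<Sum>j<n. b j * x k j) = 0"
    and "\<And>i. i < n \<Longrightarrow> x m i = 0"
  shows "sse (fun_mat n A) (fun_mat n (\<lambda>i j. A i j - x 0 i * b j))"
  using assms
proof (induction m arbitrary: n A x b)
  case 0
  then have "fun_mat n A = fun_mat n (\<lambda>i j. A i j - x 0 i * b j)" by (intro eq_matI) auto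
  then show ?case by simp
next
  case (Suc m)
  note A = Suc.prems(1) and A' = Suc.prems(2) and x = Suc.prems(3) and bx = Suc.prems(4)
    and xm = Suc.prems(5)
  define p where "p = rec_nat (\<lambda>j. 1 :: real) (\<lambda>_ p j. \<Sum>i<n. p i * A i j)"
  have p0: "p 0 = (\<lambda>j. 1)" and pS: "\<And>k. p (Suc k) = (\<lambda>j. \<Sum>i<n. p k i * A i j)"
    by (auto simp: p_def)
  have ppos: "0 < p k j" if "j < n" for k j
    using that
  proof (induction k arbitrary: j)
    case (Suc k)
    then show ?case unfolding pS using A by (intro sum_pos mult_pos_pos) auto
  qed (simp add: p0)
  have px: "(\<Sum>j<n. p k j * x l j) = (\<Sum>j<n. x (k + l) j)" for k l
  proof (induction k arbitrary: l)
    case (Suc k)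
    have "(\<Sum>j<n. p (Suc k) j * x l j) = (\<Sum>j<n. \<Sum>i<n. p k i * (A i j * x l j))"
      by (simp add: pS sum_distrib_right mult.assoc)
    also have "\<dots> = (\<Sum>i<n. \<Sum>j<n. p k i * (A i j * x l j))"
      by (rule sum.swap)
    also have "\<dots> = (\<Sum>i<n. p k i * x (Suc l) i)"
      using x by (intro sum.cong) (auto simp: sum_distrib_left)
    also have "\<dots> = (\<Sum>j<n. x (Suc k + l) j)" using Suc.IH[of "Suc l"] by simp
    finally show ?case .
  qed (simp add: p0)
  define q where "q = p (Suc m)"
  have xk: "x (Suc m + k) i = 0" if "i < n" for k i
    using that
  proof (induction k arbitrary: i)
    case (Suc k)
    then show ?case using x[of i "Suc m + k"] by simp
  qed (use xm in auto)
  have qx: "(\<Sum>j<n. q j * x k j) = 0" for k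
    unfolding q_def px using xk by simp
  have qpos: "0 < q j" if "j < n" for j using ppos that by (simp add: q_def)
  have "\<forall>\<^sub>F K in at_top. \<forall>j\<in>{..<n}. 0 < b j + K * q j"
  proof (intro eventually_ball_finite ballI)
    fix j assume "j \<in> {..<n}"
    then have q: "0 < q j" using qpos by simp
    show "\<forall>\<^sub>F K in at_top. 0 < b j + K * q j"
      using eventually_gt_at_top[of "- b j / q j"]
      by eventually_elim (use q in \<open>simp add: field_simps\<close>)
  qed auto
  from eventually_happens'[OF trivial_limit_at_top_linorder this] obtain K where K: "\<And>j. j < n \<Longrightarrow> 0 < b j + K * q j"
    by auto
  define b' where "b' j = b j + K * q j" for j
  have b'x: "(\<Sum>j<n. b' j * x k j) = 0" for k
    using bx[of k] qx[of k] by (simp add: b'_def algebra_simps sum.distrib flip: sum_distrib_left)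
  have "\<forall>\<^sub>F N :: nat in sequentially. (\<forall>i\<in>{..<n}. \<forall>j\<in>{..<n}.
      0 < A i j - 1 / real N * (x 0 i * b' j)) \<and> (\<forall>i\<in>{..<n}. \<forall>j\<in>{..<n}.
      0 < A i j - x 0 i * b j - 1 / real N * (x 0 i * b' j)) \<and> N > 0"
  proof (intro eventually_conj eventually_ball_finite ballI eventually_gt_at_top order_tendstoD(1)[where a=0])
    fix i j assume ij: "i \<in> {..<n}" "j \<in> {..<n}"
    show "(\<lambda>N. A i j - 1 / real N * (x 0 i * b' j)) \<longlonglongrightarrow> A i j - 0 * (x 0 i * b' j)"
      by (intro tendsto_diff tendsto_mult tendsto_const lim_1_over_n)
    show "(\<lambda>N. A i j - x 0 i * b j - 1 / real N * (x 0 i * b' j)) \<longlonglongrightarrow> A i j - x 0 i * b j - 0 * (x 0 i * b' j)"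
      by (intro tendsto_diff tendsto_mult tendsto_const lim_1_over_n)
    show "0 < A i j - 0 * (x 0 i * b' j)" "0 < A i j - x 0 i * b j - 0 * (x 0 i * b' j)"
      using A A' ij by auto
  qed auto
  from eventually_happens'[OF sequentially_bot this] obtain N :: nat where N: "N > 0"
    and N1: "\<And>i j. i < n \<Longrightarrow> j < n \<Longrightarrow> 0 < A i j - 1 / real N * (x 0 i * b' j)"
    and N2: "\<And>i j. i < n \<Longrightarrow> j < n \<Longrightarrow> 0 < A i j - x 0 i * b j - 1 / real N * (x 0 i * b' j)"
    by auto
  \<comment> \<open>Position \<open>s\<close> on the segment from \<open>A\<close> to \<open>A - x b\<close>, followed by a portion \<open>t\<close> of the first partial update; all these matrices have the same chain \<open>x\<close>.\<close>
  define B where "B s t i j = A i j - s * (x 0 i * b j) - t * (x 0 i * b' j)" for s t i j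
  have Bx: "(\<Sum>j<n. B s t i j * x k j) = x (Suc k) i" if "i < n" for s t i k
  proof -
    have "(\<Sum>j<n. B s t i j * x k j) = (\<Sum>j<n. A i j * x k j)
       - s * x 0 i * (\<Sum>j<n. b j * x k j) - t * x 0 i * (\<Sum>j<n. b' j * x k j)"
      by (simp add: B_def algebra_simps sum_subtractf sum.distrib sum_distrib_left)
    then show ?thesis using x[OF that] bx b'x by simp
  qed
  have Bpos0: "0 < B s 0 i j" if "i < n" "j < n" "0 \<le> s" "s \<le> 1" for s i j
  proof -
    have "B s 0 i j = (1 - s) * A i j + s * (A i j - x 0 i * b j)"
      by (simp add: B_def algebra_simps)
    then show ?thesis using A[OF that(1,2)] A'[OF that(1,2)] that(3,4)
      by (smt (verit) mult_nonneg_nonneg mult_pos_pos)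
  qed
  have Bpos1: "0 < B s (1 / real N) i j" if "i < n" "j < n" "0 \<le> s" "s \<le> 1" for s i j
  proof -
    have "B s t i j = (1 - s) * (A i j - t * (x 0 i * b' j)) + s * (A i j - x 0 i * b j - t * (x 0 i * b' j))" for t
      by (simp add: B_def algebra_simps)
    from this[of "1 / real N"] show ?thesis using N1[OF that(1,2)] N2[OF that(1,2)] that(3,4)
      by (smt (verit) mult_nonneg_nonneg mult_pos_pos)
  qed
  have upd: "sse (fun_mat n D) (fun_mat n (\<lambda>i j. D i j - z 0 i * c j))"
    if h: "\<And>i j. i < n \<Longrightarrow> j < n \<Longrightarrow> 0 < D i j"
      "\<And>i j. i < n \<Longrightarrow> j < n \<Longrightarrow> 0 < D i j - z 0 i * c j"
      "\<And>k i. i < n \<Longrightarrow> z (Suc k) i = (\<Sum>j<n. D i j * z k j)"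
      "\<And>k. (\<Sum>j<n. c j * z k j) = 0" "\<And>i. i < n \<Longrightarrow> z (Suc m) i = 0" "\<And>j. j < n \<Longrightarrow> 0 < c j"
    for D z c
  proof (rule sse_chain_update_pos[of m n D z c])
    show "sse (fun_mat n' A') (fun_mat n' (\<lambda>i j. A' i j - x' 0 i * b' j))"
      if "\<And>i j. i < n' \<Longrightarrow> j < n' \<Longrightarrow> 0 < A' i j"
        "\<And>i j. i < n' \<Longrightarrow> j < n' \<Longrightarrow> 0 < A' i j - x' 0 i * b' j"
        "\<And>k i. i < n' \<Longrightarrow> x' (Suc k) i = (\<Sum>j<n'. A' i j * x' k j)"
        "\<And>k. (\<Sum>j<n'. b' j * x' k j) = 0" "\<And>i. i < n' \<Longrightarrow> x' m i = 0" for n' A' x' b'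
      using that by (rule Suc.IH[of n' A' x' b'])
  qed (fact h)+
  have step: "sse (fun_mat n (B s 0)) (fun_mat n (B (s + 1 / real N) 0))"
    if s: "0 \<le> s" "s + 1 / real N \<le> 1" for s
  proof -
    have s1: "s \<le> 1" using s(2) N by (smt (verit) of_nat_0_less_iff zero_less_divide_1_iff)
    have 1: "sse (fun_mat n (B s 0)) (fun_mat n (\<lambda>i j. B s 0 i j - (1 / real N * x 0 i) * b' j))"
    proof (rule upd[where z = "\<lambda>k i. 1 / real N * x k i" and c = b'])
      show "0 < B s 0 i j" if "i < n" "j < n" for i j using Bpos0 that s s1 by simp
      show "0 < B s 0 i j - 1 / real N * x 0 i * b' j" if "i < n" "j < n" for i j 
        using Bpos1[OF that s(1) s1] by (simp add: B_def)
      show "1 / real N * x (Suc k) i = (\<Sum>j<n. B s 0 i j * (1 / real N * x k j))" if "i < n" for k i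
        using Bx[OF that, of s 0 k, symmetric] by (simp add: sum_divide_distrib)
      show "(\<Sum>j<n. b' j * (1 / real N * x k j)) = 0" for k
        using b'x[of k] by (simp flip: sum_divide_distrib)
      show "1 / real N * x (Suc m) i = 0" if "i < n" for i using xm that by simp
      show "0 < b' j" if "j < n" for j using K that by (simp add: b'_def)
    qed
    have 2: "fun_mat n (\<lambda>i j. B s 0 i j - (1 / real N * x 0 i) * b' j) = fun_mat n (B s (1 / real N))"
      by (simp add: B_def)
    have eq: "B s (1 / real N) i j - (- K / real N * x 0 i) * q j = B (s + 1 / real N) 0 i j" for i j
      by (simp add: B_def b'_def algebra_simps add_divide_distrib)
    have "sse (fun_mat n (B s (1 / real N))) (fun_mat n (\<lambda>i j. B s (1 / real N) i j - (- K / real N * x 0 i) * q j))"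
    proof (rule upd[where z = "\<lambda>k i. - K / real N * x k i" and c = q])
      show "0 < B s (1 / real N) i j" if "i < n" "j < n" for i j using Bpos1 that s s1 by simp
      show "0 < B s (1 / real N) i j - (- K / real N * x 0 i) * q j" if "i < n" "j < n" for i j 
        unfolding eq using that s N by (intro Bpos0) auto
      show "- K / real N * x (Suc k) i = (\<Sum>j<n. B s (1 / real N) i j * (- K / real N * x k j))" if "i < n" for k i
        unfolding Bx[OF that, of s "1 / real N" k, symmetric] sum_distrib_left by (simp add: ac_simps)
      show "(\<Sum>j<n. q j * (- K / real N * x k j)) = 0" for k
      proof -
        have "(\<Sum>j<n. q j * (- K / real N * x k j)) = - K / real N * (\<Sum>j<n. q j * x k j)"
          unfolding sum_distrib_left by (simp add: ac_simps)
        then show ?thesis using qx[of k] by simp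
      qed
      show "- K / real N * x (Suc m) i = 0" if "i < n" for i using xm that by simp
    qed (use qpos in auto)
    then have 3: "sse (fun_mat n (B s (1 / real N))) (fun_mat n (B (s + 1 / real N) 0))"
      unfolding eq .
    show ?thesis by (rule sse_trans[OF 1[unfolded 2] 3])
  qed
  have "sse (fun_mat n (B 0 0)) (fun_mat n (B (real k / real N) 0))" if "k \<le> N" for k
    using that
  proof (induction k)
    case (Suc k)
    have "real k / real N + 1 / real N = real (Suc k) / real N" by (simp add: add_divide_distrib)
    moreover have "real (Suc k) / real N \<le> 1" using Suc.prems N by (simp add: field_simps)
    ultimately have "sse (fun_mat n (B (real k / real N) 0)) (fun_mat n (B (real (Suc k) / real N) 0))"
      using step[of "real k / real N"] by simp
    then show ?case using Suc by (meson Suc_leD sse_trans)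
  qed simp
  from this[of N] show ?case using N by (simp add: B_def)
qed

lemma sse_rank_one_update:
  assumes A: "A \<in> carrier_mat n n" "positive_matrix A" and A': "positive_matrix (A - x 0 * b)"
    and b: "b \<in> carrier_mat 1 n" and x: "\<And>k. x k \<in> carrier_mat n 1"
    and chain: "\<And>k. A * x k = x (Suc k)" "x m = 0\<^sub>m n 1" and bx: "\<And>k. b * x k = 0\<^sub>m 1 1"
  shows "sse A (A - x 0 * b)"
proof -
  have dims: "dim_row (x k) = n" "dim_col (x k) = 1" "dim_row A = n" "dim_col A = n"
    "dim_row b = 1" "dim_col b = n" for k
    using x[of k] A b by auto
  have xb: "(x 0 * b) $$ (i, j) = x 0 $$ (i, 0) * b $$ (0, j)" if "i < n" "j < n" for i j
    using that dims by (simp add: index_mult_mat_sum del: index_mult_mat(1))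
  have "sse (fun_mat n (\<lambda>i j. A $$ (i, j))) (fun_mat n (\<lambda>i j. A $$ (i, j) - x 0 $$ (i, 0) * b $$ (0, j)))"
  proof (rule sse_chain_update[where x = "\<lambda>k i. x k $$ (i, 0)" and m = m])
    show "0 < A $$ (i, j)" if "i < n" "j < n" for i j
      using A that by (auto simp: positive_matrix_def)
    show "0 < A $$ (i, j) - x 0 $$ (i, 0) * b $$ (0, j)" if "i < n" "j < n" for i j
    proof -
      have "0 < (A - x 0 * b) $$ (i, j)"
        using A' that dims by (simp add: positive_matrix_def del: index_minus_mat(1) index_mult_mat(1))
      then show ?thesis using that dims by (simp add: xb[OF that] del: index_mult_mat(1))
    qed
    show "x (Suc k) $$ (i, 0) = (\<Sum>j<n. A $$ (i, j) * x k $$ (j, 0))" if "i < n" for k i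
      using that dims by (simp add: index_mult_mat_sum flip: chain(1) del: index_mult_mat(1))
    show "(\<Sum>j<n. b $$ (0, j) * x k $$ (j, 0)) = 0" for k
      using arg_cong[OF bx[of k], of "\<lambda>M. M $$ (0, 0)"] dims
      by (simp add: index_mult_mat_sum del: index_mult_mat(1))
    show "x m $$ (i, 0) = 0" if "i < n" for i using that chain(2) by simp
  qed
  moreover have "fun_mat n (\<lambda>i j. A $$ (i, j)) = A"
    using dims by (intro eq_matI) auto
  moreover have "fun_mat n (\<lambda>i j. A $$ (i, j) - x 0 $$ (i, 0) * b $$ (0, j)) = A - x 0 * b"
    using dims by (intro eq_matI) (auto simp: xb simp del: index_mult_mat(1))
  ultimately show ?thesis by simp
qed

section \<open>Orthogonal deflation of the generalized kernel\<close>

definition orthonormal_mat :: "nat \<Rightarrow> real mat \<Rightarrow> bool" where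
  "orthonormal_mat n Q \<longleftrightarrow>
     Q \<in> carrier_mat n n \<and> transpose_mat Q * Q = 1\<^sub>m n \<and> Q * transpose_mat Q = 1\<^sub>m n"

lemma orthonormal_mat_one: "orthonormal_mat n (1\<^sub>m n)"
  unfolding orthonormal_mat_def by simp

lemma orthonormal_mat_mult:
  assumes "orthonormal_mat n Q" "orthonormal_mat n R"
  shows "orthonormal_mat n (Q * R)"
proof -
  have Q: "Q \<in> carrier_mat n n" and R: "R \<in> carrier_mat n n"
    using assms by (auto simp: orthonormal_mat_def)
  have [simp]: "dim_row Q = n" "dim_col Q = n" "dim_row R = n" "dim_col R = n" using Q R by auto
  have t: "transpose_mat (Q * R) = transpose_mat R * transpose_mat Q"
    by (rule transpose_mult[OF Q R])
  have "transpose_mat (Q * R) * (Q * R) = transpose_mat R * (transpose_mat Q * (Q * R))"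
    unfolding t by (simp add: mult_mat_assoc)
  moreover have "Q * R * transpose_mat (Q * R) = Q * (R * (transpose_mat R * transpose_mat Q))"
    unfolding t by (simp add: mult_mat_assoc)
  ultimately show ?thesis
    using assms Q R by (auto simp: orthonormal_mat_def mult_mat_cancel[where n=n])
qed

text \<open>
  A Householder reflection: \<open>Q\<close> reflects in the hyperplane orthogonal to \<open>w = v - e\<close>, where \<open>e\<close> is the
  first unit vector, and so exchanges \<open>e\<close> and \<open>v\<close>; for \<open>v = e\<close> it degenerates to the identity.
\<close>

lemma orthonormal_mat_first_column:
  fixes v :: "nat \<Rightarrow> real"
  assumes n: "0 < n" and v: "(\<Sum>i<n. (v i)\<^sup>2) = 1"
  obtains Q where "orthonormal_mat n Q" "\<And>i. i < n \<Longrightarrow> Q $$ (i, 0) = v i"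
proof -
  define w where "w i = v i - (if i = 0 then 1 else 0)" for i
  define s where "s = (\<Sum>i<n. (w i)\<^sup>2)"
  have "s = (\<Sum>i<n. (v i)\<^sup>2 + (if i = 0 then 1 - 2 * v i else 0))"
    unfolding s_def w_def by (intro sum.cong) (auto simp: power2_eq_square algebra_simps)
  then have s: "s = 2 - 2 * v 0"
    using n v by (simp add: sum.distrib)
  show ?thesis
  proof (cases "s = 0")
    case True
    then have "w i = 0" if "i < n" for i
      using that unfolding s_def by (simp add: sum_nonneg_eq_0_iff)
    then show ?thesis
      using that[of "1\<^sub>m n"] n orthonormal_mat_one unfolding w_def by force
  next
    case False
    define c where "c = 2 / s"
    have cs: "c * s = 2" using False by (simp add: c_def)
    define Q where "Q = mat n n (\<lambda>(i, j). (if i = j then 1 else 0) - c * w i * w j)"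
    have [simp]: "dim_row Q = n" "dim_col Q = n" by (auto simp: Q_def)
    have sym: "transpose_mat Q = Q"
      by (rule eq_matI) (auto simp: Q_def)
    have "Q * Q = 1\<^sub>m n"
    proof (rule eq_matI)
      fix i j assume "i < dim_row (1\<^sub>m n :: real mat)" "j < dim_col (1\<^sub>m n :: real mat)"
      then have ij: "i < n" "j < n" by auto
      have "(Q * Q) $$ (i, j) = (\<Sum>k<n. ((if i = k then 1 else 0) - c * w i * w k) *
          ((if k = j then 1 else 0) - c * w k * w j))"
        using ij by (subst index_mult_mat_sum) (auto simp: Q_def)
      also have "\<dots> = (\<Sum>k<n. (if k = i then (if k = j then 1 else 0) - c * w i * w j else 0)
          - (if k = j then c * w i * w j else 0) + c * c * w i * w j * (w k)\<^sup>2)"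
        by (intro sum.cong) (auto simp: algebra_simps power2_eq_square)
      also have "\<dots> = (if i = j then 1 else 0) - 2 * c * w i * w j + c * (c * s) * w i * w j"
        using ij by (simp add: sum.distrib sum_subtractf s_def flip: sum_distrib_left)
      also have "\<dots> = 1\<^sub>m n $$ (i, j)" using ij unfolding cs by simp
      finally show "(Q * Q) $$ (i, j) = 1\<^sub>m n $$ (i, j)" .
    qed auto
    then have "orthonormal_mat n Q"
      unfolding orthonormal_mat_def sym by (auto intro: carrier_matI)
    moreover have "Q $$ (i, 0) = v i" if "i < n" for i
    proof -
      have "c * w 0 = - 1" using False s by (simp add: c_def w_def field_simps)
      moreover have "Q $$ (i, 0) = (if i = 0 then 1 else 0) - (c * w 0) * w i"
        using that n by (simp add: Q_def)
      ultimately show ?thesis by (simp add: w_def)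
    qed
    ultimately show ?thesis by (rule that)
  qed
qed

lemma unit_kernel_vector:
  fixes A :: "real mat"
  assumes A: "A \<in> carrier_mat n n" and d: "Determinant.det A = 0"
  obtains v where "0 < n" "(\<Sum>i<n. (v i)\<^sup>2) = 1" "\<And>i. i < n \<Longrightarrow> (\<Sum>j<n. A $$ (i, j) * v j) = 0"
proof -
  obtain u where u: "u \<in> carrier_vec n" "u \<noteq> 0\<^sub>v n" "A *\<^sub>v u = 0\<^sub>v n"
    using d det_0_iff_vec_prod_zero_field[OF A] by auto
  define s where "s = (\<Sum>i<n. (u $ i)\<^sup>2)"
  have "\<exists>i<n. u $ i \<noteq> 0"
  proof (rule ccontr)
    assume "\<not> ?thesis"
    then have "u = 0\<^sub>v n" using u(1) by (intro eq_vecI) auto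
    then show False using u(2) by simp
  qed
  then obtain i where i: "i < n" "u $ i \<noteq> 0" by blast
  have "s \<noteq> 0"
    using i unfolding s_def by (auto simp: sum_nonneg_eq_0_iff)
  moreover have "s \<ge> 0" unfolding s_def by (intro sum_nonneg) auto
  ultimately have s: "s > 0" by simp
  have Au: "(\<Sum>j<n. A $$ (i, j) * u $ j) = 0" if "i < n" for i
    using arg_cong[OF u(3), of "\<lambda>v. v $ i"] that A u(1)
    by (auto simp: scalar_prod_def atLeast0LessThan)
  show ?thesis
  proof (rule that[of "\<lambda>i. u $ i / sqrt s"])
    show "(\<Sum>i<n. (u $ i / sqrt s)\<^sup>2) = 1"
      using s by (simp add: power_divide s_def[symmetric] flip: sum_divide_distrib)
    show "(\<Sum>j<n. A $$ (i, j) * (u $ j / sqrt s)) = 0" if "i < n" for i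
      using Au[OF that] by (simp flip: sum_divide_distrib)
  qed (use i in auto)
qed

lemma det_nonzero_inverse:
  fixes A :: "real mat"
  assumes A: "A \<in> carrier_mat n n" and d: "Determinant.det A \<noteq> 0"
  obtains B where "B \<in> carrier_mat n n" "A * B = 1\<^sub>m n" "B * A = 1\<^sub>m n"
proof
  let ?B = "(1 / Determinant.det A) \<cdot>\<^sub>m adj_mat A"
  show "?B \<in> carrier_mat n n" using adj_mat(1)[OF A] by simp
  show "A * ?B = 1\<^sub>m n"
    using mult_smult_distrib[OF A adj_mat(1)[OF A]] d adj_mat(2)[OF A] by auto
  show "?B * A = 1\<^sub>m n"
    using mult_smult_assoc_mat[OF adj_mat(1)[OF A] A] d adj_mat(3)[OF A] by auto
qed

text \<open>
  The first \<open>k\<close> columns are strictly upper triangular.  In particular they vanish below row \<open>k\<close>, so the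
  matrix is block upper triangular with a nilpotent first block of size \<open>k\<close>.
\<close>

definition strictly_upper_columns :: "nat \<Rightarrow> real mat \<Rightarrow> bool" where
  "strictly_upper_columns k P \<longleftrightarrow> (\<forall>j<k. \<forall>i. j \<le> i \<longrightarrow> i < dim_row P \<longrightarrow> P $$ (i, j) = 0)"

definition lower_block :: "nat \<Rightarrow> real mat \<Rightarrow> real mat" where
  "lower_block k P = mat (dim_row P - k) (dim_col P - k) (\<lambda>(i, j). P $$ (i + k, j + k))"

lemma lower_block_carrier: "P \<in> carrier_mat n m \<Longrightarrow> lower_block k P \<in> carrier_mat (n - k) (m - k)"
  by (auto simp: lower_block_def)

text \<open>
  As long as the matrix is singular, rotate a unit vector of its kernel to the first coordinate; this
  clears the first column, and the remaining lower right block has smaller size.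
\<close>

lemma orthogonal_kernel_deflation:
  fixes A :: "real mat"
  assumes "A \<in> carrier_mat n n"
  shows "\<exists>Q k. orthonormal_mat n Q \<and> k \<le> n \<and>
     strictly_upper_columns k (transpose_mat Q * A * Q) \<and>
     Determinant.det (lower_block k (transpose_mat Q * A * Q)) \<noteq> 0"
  using assms
proof (induction n arbitrary: A)
  case 0
  then have "Determinant.det (lower_block 0 (transpose_mat (1\<^sub>m 0) * A * 1\<^sub>m 0)) \<noteq> 0"
    by (subst det_dim_zero) (auto simp: lower_block_def)
  then show ?case
    using orthonormal_mat_one[of 0] by (force simp: strictly_upper_columns_def)
next
  case (Suc n)
  note A = Suc.prems
  show ?case
  proof (cases "Determinant.det A = 0")
    case False
    have "transpose_mat (1\<^sub>m (Suc n)) * A * 1\<^sub>m (Suc n) = A" using A by simp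
    moreover have "lower_block 0 A = A" by (rule eq_matI) (auto simp: lower_block_def)
    ultimately show ?thesis
      using False orthonormal_mat_one[of "Suc n"]
      by (intro exI[of _ "1\<^sub>m (Suc n)"] exI[of _ 0]) (auto simp: strictly_upper_columns_def)
  next
    case True
    obtain v where v: "(\<Sum>i<Suc n. (v i)\<^sup>2) = 1"
      and Av: "\<And>i. i < Suc n \<Longrightarrow> (\<Sum>j<Suc n. A $$ (i, j) * v j) = 0"
      using unit_kernel_vector[OF A True] by metis
    obtain Q0 where Q0: "orthonormal_mat (Suc n) Q0" and Q0v: "\<And>i. i < Suc n \<Longrightarrow> Q0 $$ (i, 0) = v i"
      using orthonormal_mat_first_column[OF _ v] by auto
    have Q0c: "Q0 \<in> carrier_mat (Suc n) (Suc n)" using Q0 by (auto simp: orthonormal_mat_def)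
    have [simp]: "dim_row Q0 = Suc n" "dim_col Q0 = Suc n" "dim_row A = Suc n" "dim_col A = Suc n"
      using Q0c A by auto
    have AQ0: "(A * Q0) $$ (i, 0) = 0" if "i < Suc n" for i
      using that Av[OF that] by (subst index_mult_mat_sum) (auto simp: Q0v simp del: sum.lessThan_Suc)
    define B where "B = transpose_mat Q0 * (A * Q0)"
    have [simp]: "dim_row B = Suc n" "dim_col B = Suc n" by (auto simp: B_def)
    have B0: "B $$ (i, 0) = 0" if "i < Suc n" for i
      unfolding B_def using that AQ0 by (subst index_mult_mat_sum) (auto simp del: index_mult_mat(1))
    define A1 where "A1 = lower_block 1 B"
    define w where "w = mat 1 n (\<lambda>(i, j). B $$ (0, Suc j))"
    have A1: "A1 \<in> carrier_mat n n" and w: "w \<in> carrier_mat 1 n"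
      by (auto simp: A1_def lower_block_def w_def)
    have B: "B = four_block_mat (0\<^sub>m 1 1) w (0\<^sub>m n 1) A1"
      by (rule eq_matI) (use B0 in \<open>auto simp: A1_def lower_block_def w_def less_Suc_eq_0_disj\<close>)
    from Suc.IH[OF A1] obtain Q1 k where Q1: "orthonormal_mat n Q1" and k: "k \<le> n"
      and su: "strictly_upper_columns k (transpose_mat Q1 * A1 * Q1)"
      and dt: "Determinant.det (lower_block k (transpose_mat Q1 * A1 * Q1)) \<noteq> 0" by blast
    have Q1c: "Q1 \<in> carrier_mat n n" "transpose_mat Q1 \<in> carrier_mat n n"
      and Q1o: "transpose_mat Q1 * Q1 = 1\<^sub>m n" "Q1 * transpose_mat Q1 = 1\<^sub>m n"
      using Q1 by (auto simp: orthonormal_mat_def)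
    define P1 where "P1 = transpose_mat Q1 * A1 * Q1"
    have P1: "P1 \<in> carrier_mat n n" using Q1c A1 by (auto simp: P1_def)
    define Q2 where "Q2 = four_block_mat (1\<^sub>m 1) (0\<^sub>m 1 n) (0\<^sub>m n 1) Q1"
    have [simp]: "dim_row Q2 = Suc n" "dim_col Q2 = Suc n" using Q1c by (auto simp: Q2_def)
    have Q2t: "transpose_mat Q2 = four_block_mat (1\<^sub>m 1) (0\<^sub>m 1 n) (0\<^sub>m n 1) (transpose_mat Q1)"
      unfolding Q2_def using Q1c
      by (subst transpose_four_block_mat[of _ 1 1 _ n _ n]) (auto simp: zero_transpose_mat)
    have one: "four_block_mat (1\<^sub>m 1) (0\<^sub>m 1 n) (0\<^sub>m n 1) (1\<^sub>m n) = (1\<^sub>m (Suc n) :: real mat)"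
      by (rule eq_matI) auto
    have "transpose_mat Q2 * Q2 = 1\<^sub>m (Suc n)" "Q2 * transpose_mat Q2 = 1\<^sub>m (Suc n)"
      unfolding Q2t unfolding Q2_def one[symmetric] using Q1c Q1o
      by (subst mult_four_block_mat[of _ 1 1 _ n _ n _ _ 1 _ n]; auto simp: left_add_zero_mat right_add_zero_mat)+
    then have Q2: "orthonormal_mat (Suc n) Q2"
      by (auto simp: orthonormal_mat_def)
    have "B * Q2 = four_block_mat (0\<^sub>m 1 1) (w * Q1) (0\<^sub>m n 1) (A1 * Q1)"
      unfolding B Q2_def using Q1c A1 w
      by (subst mult_four_block_mat[of _ 1 1 _ n _ n _ _ 1 _ n]) auto
    then have P: "transpose_mat Q2 * (B * Q2) = four_block_mat (0\<^sub>m 1 1) (w * Q1) (0\<^sub>m n 1) P1"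
      unfolding Q2t P1_def using Q1c A1 w
      by (simp, subst mult_four_block_mat[of _ 1 1 _ n _ n _ _ 1 _ n]) (auto simp: mult_mat_assoc)
    have t: "transpose_mat (Q0 * Q2) = transpose_mat Q2 * transpose_mat Q0"
      by (rule transpose_mult[of _ "Suc n" "Suc n" _ "Suc n"]) (auto intro: carrier_matI)
    have "transpose_mat (Q0 * Q2) * A * (Q0 * Q2) = transpose_mat Q2 * (B * Q2)"
      unfolding B_def t by (simp add: mult_mat_assoc)
    note PP = this[unfolded P]
    have "strictly_upper_columns (Suc k) (four_block_mat (0\<^sub>m 1 1) (w * Q1) (0\<^sub>m n 1) P1)"
      unfolding strictly_upper_columns_def
    proof (intro allI impI)
      fix j i assume "j < Suc k" "j \<le> i" "i < dim_row (four_block_mat (0\<^sub>m 1 1) (w * Q1) (0\<^sub>m n 1) P1)"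
      then have h: "j < Suc k" "j \<le> i" "i < Suc n" using P1 by auto
      then show "four_block_mat (0\<^sub>m 1 1) (w * Q1) (0\<^sub>m n 1) P1 $$ (i, j) = 0"
        using su[folded P1_def] P1 k unfolding strictly_upper_columns_def
        by (cases j; cases i) auto
    qed
    moreover have "lower_block (Suc k) (four_block_mat (0\<^sub>m 1 1) (w * Q1) (0\<^sub>m n 1) P1) = lower_block k P1"
      by (rule eq_matI) (use P1 in \<open>auto simp: lower_block_def\<close>)
    ultimately show ?thesis
      using k dt orthonormal_mat_mult[OF Q0 Q2]
      by (intro exI[of _ "Q0 * Q2"] exI[of _ "Suc k"]) (auto simp: PP P1_def)
  qed
qed

section \<open>Similarity of the blocks off the generalized kernel\<close>

text \<open>
  Since \<open>P\<close> is block upper triangular, only its lower block contributes to the lower rows of the product.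
\<close>

lemma lower_block_mult:
  assumes P: "P \<in> carrier_mat n n" and R: "R \<in> carrier_mat n n" and k: "k \<le> n"
    and z: "\<And>i j. k \<le> i \<Longrightarrow> i < n \<Longrightarrow> j < k \<Longrightarrow> P $$ (i, j) = 0"
  shows "lower_block k (P * R) = lower_block k P * lower_block k R"
proof (rule eq_matI)
  have [simp]: "dim_row P = n" "dim_col P = n" "dim_row R = n" "dim_col R = n" using P R by auto
  fix i j assume "i < dim_row (lower_block k P * lower_block k R)" "j < dim_col (lower_block k P * lower_block k R)"
  then have ij: "i < n - k" "j < n - k" by (auto simp: lower_block_def)
  have "lower_block k (P * R) $$ (i, j) = (\<Sum>l<n. P $$ (i + k, l) * R $$ (l, j + k))"
    using ij by (simp add: lower_block_def index_mult_mat_sum del: index_mult_mat(1))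
  also have "\<dots> = (\<Sum>l\<in>{k..<n}. P $$ (i + k, l) * R $$ (l, j + k))"
    using ij z by (intro sum.mono_neutral_right) auto
  also have "\<dots> = (\<Sum>l<n - k. P $$ (i + k, l + k) * R $$ (l + k, j + k))"
    using k sum.shift_bounds_nat_ivl[of "\<lambda>l. P $$ (i + k, l) * R $$ (l, j + k)" 0 k "n - k"]
    by (simp add: atLeast0LessThan)
  also have "\<dots> = (lower_block k P * lower_block k R) $$ (i, j)"
    using ij by (subst index_mult_mat_sum) (auto simp: lower_block_def)
  finally show "lower_block k (P * R) $$ (i, j) = (lower_block k P * lower_block k R) $$ (i, j)" .
qed (auto simp: lower_block_def)

lemma lower_block_pow:
  assumes P: "P \<in> carrier_mat n n" and k: "k \<le> n" and su: "strictly_upper_columns k P"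
  shows "lower_block k (P ^\<^sub>m l) = lower_block k P ^\<^sub>m l"
    and "\<And>i j. k \<le> i \<Longrightarrow> i < n \<Longrightarrow> j < k \<Longrightarrow> (P ^\<^sub>m l) $$ (i, j) = 0"
proof (induction l)
  case 0
  show "lower_block k (P ^\<^sub>m 0) = lower_block k P ^\<^sub>m 0"
    using P by (intro eq_matI) (auto simp: lower_block_def)
  show "\<And>i j. k \<le> i \<Longrightarrow> i < n \<Longrightarrow> j < k \<Longrightarrow> (P ^\<^sub>m 0) $$ (i, j) = 0"
    using P by auto
next
  case (Suc l)
  have Pl: "P ^\<^sub>m l \<in> carrier_mat n n" using P by simp
  have su': "P $$ (i, j) = 0" if "k \<le> i" "i < n" "j < k" for i j
    using su that P unfolding strictly_upper_columns_def by auto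
  show "lower_block k (P ^\<^sub>m Suc l) = lower_block k P ^\<^sub>m Suc l"
    using lower_block_mult[OF Pl P k Suc.IH(2)] Suc.IH(1) by simp
  fix i j assume ij: "k \<le> i" "i < n" "j < k"
  have "(P ^\<^sub>m Suc l) $$ (i, j) = (\<Sum>r<n. (P ^\<^sub>m l) $$ (i, r) * P $$ (r, j))"
    using ij k P Pl by (simp add: index_mult_mat_sum del: index_mult_mat(1))
  also have "\<dots> = 0"
    using Suc.IH(2)[OF ij(1,2)] su'[OF _ _ ij(3)]
    by (intro sum.neutral ballI) (metis lessThan_iff mult_eq_0_iff not_le)
  finally show "(P ^\<^sub>m Suc l) $$ (i, j) = 0" .
qed

lemma det_pow_nonzero:
  fixes A :: "real mat"
  assumes "A \<in> carrier_mat n n" "Determinant.det A \<noteq> 0"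
  shows "Determinant.det (A ^\<^sub>m l) \<noteq> 0"
proof (induction l)
  case (Suc l)
  then show ?case using assms by (simp add: det_mult[of _ n])
qed (use assms in simp)

lemma mat_tendsto_lower_block:
  assumes "mat_tendsto X L"
  shows "mat_tendsto (\<lambda>i. lower_block k (X i)) (lower_block k L)"
  using assms unfolding mat_tendsto_def lower_block_def by auto

text \<open>
  The first \<open>k\<close> unit vectors are killed by a power of \<open>P'\<close>, so the intertwining matrix \<open>R\<close> maps them into
  the generalized kernel of \<open>P\<close>.  This kernel is again spanned by the first \<open>k\<close> unit vectors, because
  the lower block of \<open>P\<close> is invertible.  So \<open>R\<close> is block triangular and its lower block
  intertwines the lower blocks.  That block is invertible since its determinant divides that of a
  power of the invertible lower block of \<open>P\<close>.
\<close>

lemma shift_equivalent_lower_blocks_similar: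
  assumes P: "P \<in> carrier_mat n n" and P': "P' \<in> carrier_mat n n" and k: "k \<le> n"
    and su: "strictly_upper_columns k P" and su': "strictly_upper_columns k P'"
    and det: "Determinant.det (lower_block k P) \<noteq> 0"
    and R: "R \<in> carrier_mat n n" and S: "S \<in> carrier_mat n n"
    and PR: "P * R = R * P'" and RS: "P ^\<^sub>m l = R * S"
  obtains U V where "U \<in> carrier_mat (n - k) (n - k)" "V \<in> carrier_mat (n - k) (n - k)"
    "U * V = 1\<^sub>m (n - k)" "V * U = 1\<^sub>m (n - k)" "lower_block k P * U = U * lower_block k P'"
proof -
  have [simp]: "dim_row P = n" "dim_col P = n" "dim_row P' = n" "dim_col P' = n"
    "dim_row R = n" "dim_col R = n" using P P' R by auto
  have z: "P $$ (i, j) = 0" if "k \<le> i" "i < n" "j < k" for i j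
    using su that unfolding strictly_upper_columns_def by auto
  have Rz: "R $$ (i, j) = 0" if "k \<le> i" "i < n" "j < k" for i j
    using that
  proof (induction j arbitrary: i rule: less_induct)
    case (less j)
    define r where "r = vec (n - k) (\<lambda>i. R $$ (i + k, j))"
    have "lower_block k P *\<^sub>v r = 0\<^sub>v (n - k)"
    proof (rule eq_vecI)
      fix i assume "i < dim_vec (0\<^sub>v (n - k) :: real vec)"
      then have i: "i < n - k" by simp
      have "(lower_block k P *\<^sub>v r) $ i = (\<Sum>l<n - k. P $$ (i + k, l + k) * R $$ (l + k, j))"
        using i by (simp add: scalar_prod_def lower_block_def r_def atLeast0LessThan)
      also have "\<dots> = (\<Sum>l\<in>{k..<n}. P $$ (i + k, l) * R $$ (l, j))"
        using k sum.shift_bounds_nat_ivl[of "\<lambda>l. P $$ (i + k, l) * R $$ (l, j)" 0 k "n - k"]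
        by (simp add: atLeast0LessThan)
      also have "\<dots> = (\<Sum>l<n. P $$ (i + k, l) * R $$ (l, j))"
        using i z by (intro sum.mono_neutral_left) auto
      also have "\<dots> = (P * R) $$ (i + k, j)"
        using i less.prems k by (subst index_mult_mat_sum) auto
      also have "\<dots> = (\<Sum>l<n. R $$ (i + k, l) * P' $$ (l, j))"
        unfolding PR using i less.prems k by (subst index_mult_mat_sum) auto
      also have "\<dots> = 0"
      proof (intro sum.neutral ballI)
        fix l assume l: "l \<in> {..<n}"
        show "R $$ (i + k, l) * P' $$ (l, j) = 0"
        proof (cases "l < j")
          case True
          then show ?thesis using less.IH[OF True, of "i + k"] less.prems i by simp
        next
          case False
          then show ?thesis using su' less.prems l unfolding strictly_upper_columns_def by auto
        qed
      qed
      finally show "(lower_block k P *\<^sub>v r) $ i = 0\<^sub>v (n - k) $ i" using i by simp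
    qed (auto simp: lower_block_def)
    moreover have "r \<in> carrier_vec (n - k)" by (simp add: r_def)
    ultimately have "r = 0\<^sub>v (n - k)"
      using det det_0_iff_vec_prod_zero_field[OF lower_block_carrier[OF P], of k] by blast
    then have "r $ (i - k) = 0" using less.prems by simp
    moreover have "i - k + k = i" "i - k < n - k" using less.prems by auto
    ultimately show ?case by (simp add: r_def)
  qed
  define U where "U = lower_block k R"
  have U: "U \<in> carrier_mat (n - k) (n - k)" using lower_block_carrier[OF R] by (simp add: U_def)
  have "lower_block k P ^\<^sub>m l = U * lower_block k S"
    unfolding lower_block_pow(1)[OF P k su, symmetric] RS U_def by (rule lower_block_mult[OF R S k Rz])
  then have "Determinant.det U \<noteq> 0"
    using det_pow_nonzero[OF lower_block_carrier[OF P] det, of l] det_mult[OF U lower_block_carrier[OF S]]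
    by auto
  then obtain V where V: "V \<in> carrier_mat (n - k) (n - k)" "U * V = 1\<^sub>m (n - k)" "V * U = 1\<^sub>m (n - k)"
    using det_nonzero_inverse[OF U] by metis
  have "lower_block k P * U = lower_block k (P * R)"
    unfolding U_def by (rule lower_block_mult[OF P R k z, symmetric])
  also have "\<dots> = U * lower_block k P'"
    unfolding PR U_def by (rule lower_block_mult[OF R P' k Rz])
  finally show ?thesis using that[OF U V] by blast
qed

lemma conjugate_pow:
  fixes A :: "real mat"
  assumes Q: "orthonormal_mat n Q" and A: "A \<in> carrier_mat n n"
  shows "(transpose_mat Q * A * Q) ^\<^sub>m l = transpose_mat Q * A ^\<^sub>m l * Q"
proof (induction l)
  case 0
  then show ?case using Q A by (auto simp: orthonormal_mat_def)
next
  case (Suc l)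
  have [simp]: "dim_row Q = n" "dim_col Q = n" "dim_row A = n" "dim_col A = n"
    "dim_row (A ^\<^sub>m l) = n" "dim_col (A ^\<^sub>m l) = n" and QQ: "Q * transpose_mat Q = 1\<^sub>m n"
    using Q A by (auto simp: orthonormal_mat_def)
  show ?case using Suc.IH by (simp add: mult_mat_assoc mult_mat_cancel[OF QQ])
qed

lemma shift_equivalent_conjugate_lower_blocks:
  assumes A: "A \<in> carrier_mat n n" and B: "B \<in> carrier_mat n n"
    and SE: "shift_equivalent_over UNIV A B"
    and Q: "orthonormal_mat n Q" and R: "orthonormal_mat n R" and k: "k \<le> n"
    and su: "strictly_upper_columns k (transpose_mat Q * A * Q)"
    and su': "strictly_upper_columns k (transpose_mat R * B * R)"
    and det: "Determinant.det (lower_block k (transpose_mat Q * A * Q)) \<noteq> 0"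
  obtains U V where "U \<in> carrier_mat (n - k) (n - k)" "V \<in> carrier_mat (n - k) (n - k)"
    "U * V = 1\<^sub>m (n - k)" "V * U = 1\<^sub>m (n - k)"
    "lower_block k (transpose_mat Q * A * Q) * U = U * lower_block k (transpose_mat R * B * R)"
proof -
  obtain X Y l where X: "X \<in> carrier_mat n n" and Y: "Y \<in> carrier_mat n n"
    and Al: "A ^\<^sub>m l = X * Y" and AX: "A * X = X * B"
  proof -
    from SE obtain p q X Y l where "A \<in> carrier_mat p p" "B \<in> carrier_mat q q"
      and *: "X \<in> carrier_mat p q" "Y \<in> carrier_mat q p" "A ^\<^sub>m l = X * Y" "A * X = X * B"
      unfolding shift_equivalent_over_def mats_over_def by auto
    then have "p = n" "q = n" using A B by auto
    then show ?thesis using * that by blast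
  qed
  have [simp]: "dim_row Q = n" "dim_col Q = n" "dim_row R = n" "dim_col R = n"
    "dim_row A = n" "dim_col A = n" "dim_row B = n" "dim_col B = n"
    "dim_row X = n" "dim_col X = n" "dim_row Y = n" "dim_col Y = n"
    and QQ: "Q * transpose_mat Q = 1\<^sub>m n" and RR: "R * transpose_mat R = 1\<^sub>m n"
    using Q R A B X Y by (auto simp: orthonormal_mat_def)
  show ?thesis
  proof (rule shift_equivalent_lower_blocks_similar[OF _ _ k su su' det])
    have "A * (X * R) = X * (B * R)" by (simp add: AX flip: mult_mat_assoc)
    then show "transpose_mat Q * A * Q * (transpose_mat Q * X * R) =
        transpose_mat Q * X * R * (transpose_mat R * B * R)"
      by (simp add: mult_mat_assoc mult_mat_cancel[OF QQ] mult_mat_cancel[OF RR])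
    show "(transpose_mat Q * A * Q) ^\<^sub>m l = transpose_mat Q * X * R * (transpose_mat R * Y * Q)"
      unfolding conjugate_pow[OF Q A] Al by (simp add: mult_mat_assoc mult_mat_cancel[OF RR])
  qed (use that in \<open>auto intro: carrier_matI\<close>)
qed

section \<open>Conjugators of convergent similar matrices\<close>

text \<open>
  If the number \<open>r\<close> of columns of \<open>F\<close> is least possible, then \<open>F\<close> is injective: otherwise rotate a kernel
  vector of \<open>F\<close> to the first coordinate, so that the first column of \<open>F\<close> becomes zero and can be
  dropped.  For an injective \<open>F\<close> the Gram matrix \<open>transpose F * F\<close> is invertible.
\<close>

lemma minimal_factorization_left_inverse:
  fixes A :: "real mat"
  assumes F: "F \<in> carrier_mat n r" and K: "K \<in> carrier_mat r m" and A: "A = F * K"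
    and min: "\<And>s F' K'. F' \<in> carrier_mat n s \<Longrightarrow> K' \<in> carrier_mat s m \<Longrightarrow> A = F' * K' \<Longrightarrow> r \<le> s"
  obtains F' where "F' \<in> carrier_mat r n" "F' * F = 1\<^sub>m r"
proof -
  have [simp]: "dim_row F = n" "dim_col F = r" "dim_row K = r" "dim_col K = m" using F K by auto
  define G where "G = transpose_mat F * F"
  have G: "G \<in> carrier_mat r r" unfolding G_def by (intro carrier_matI) auto
  have "Determinant.det G \<noteq> 0"
  proof
    assume "Determinant.det G = 0"
    then obtain v where r: "0 < r" and v: "(\<Sum>i<r. (v i)\<^sup>2) = 1"
      and Gv: "\<And>i. i < r \<Longrightarrow> (\<Sum>j<r. G $$ (i, j) * v j) = 0"
      using unit_kernel_vector[OF G] by metis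
    define u where "u a = (\<Sum>j<r. F $$ (a, j) * v j)" for a
    have "(\<Sum>a<n. (u a)\<^sup>2) = (\<Sum>a<n. \<Sum>i<r. \<Sum>j<r. v i * (F $$ (a, i) * F $$ (a, j) * v j))"
      unfolding u_def power2_eq_square sum_product by (intro sum.cong refl) (simp add: ac_simps)
    also have "\<dots> = (\<Sum>i<r. \<Sum>a<n. \<Sum>j<r. v i * (F $$ (a, i) * F $$ (a, j) * v j))"
      by (rule sum.swap)
    also have "\<dots> = (\<Sum>i<r. \<Sum>j<r. \<Sum>a<n. v i * (F $$ (a, i) * F $$ (a, j) * v j))"
      by (intro sum.cong refl sum.swap)
    also have "\<dots> = (\<Sum>i<r. v i * (\<Sum>j<r. G $$ (i, j) * v j))"
    proof (intro sum.cong refl)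
      fix i assume "i \<in> {..<r}"
      then have "G $$ (i, j) = (\<Sum>a<n. F $$ (a, i) * F $$ (a, j))" if "j < r" for j
        unfolding G_def using that by (subst index_mult_mat_sum) auto
      then show "(\<Sum>j<r. \<Sum>a<n. v i * (F $$ (a, i) * F $$ (a, j) * v j)) = v i * (\<Sum>j<r. G $$ (i, j) * v j)"
        by (simp add: sum_distrib_left sum_distrib_right)
    qed
    also have "\<dots> = 0" using Gv by simp
    finally have u: "u a = 0" if "a < n" for a
      using that by (simp add: sum_nonneg_eq_0_iff)
    obtain Q where Q: "orthonormal_mat r Q" and Qv: "\<And>i. i < r \<Longrightarrow> Q $$ (i, 0) = v i"
      using orthonormal_mat_first_column[OF r v] by blast
    have [simp]: "dim_row Q = r" "dim_col Q = r" and QQ: "Q * transpose_mat Q = 1\<^sub>m r"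
      using Q by (auto simp: orthonormal_mat_def)
    have FQ: "(F * Q) $$ (a, 0) = 0" if "a < n" for a
      using u[OF that] that r by (subst index_mult_mat_sum) (auto simp: u_def Qv)
    define F2 where "F2 = mat n (r - 1) (\<lambda>(i, j). (F * Q) $$ (i, Suc j))"
    define K2 where "K2 = mat (r - 1) m (\<lambda>(i, j). (transpose_mat Q * K) $$ (Suc i, j))"
    have "A = F * Q * (transpose_mat Q * K)"
      unfolding A by (simp add: mult_mat_assoc mult_mat_cancel[OF QQ])
    also have "\<dots> = F2 * K2"
    proof (rule eq_matI)
      fix i j assume "i < dim_row (F2 * K2)" "j < dim_col (F2 * K2)"
      then have ij: "i < n" "j < m" by (auto simp: F2_def K2_def)
      have "(F * Q * (transpose_mat Q * K)) $$ (i, j) =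
          (\<Sum>l<Suc (r - 1). (F * Q) $$ (i, l) * (transpose_mat Q * K) $$ (l, j))"
        using ij r by (subst index_mult_mat_sum) auto
      also have "\<dots> = (\<Sum>l<r - 1. (F * Q) $$ (i, Suc l) * (transpose_mat Q * K) $$ (Suc l, j))"
        unfolding sum.lessThan_Suc_shift using FQ[OF ij(1)] by simp
      also have "\<dots> = (F2 * K2) $$ (i, j)"
        using ij by (subst index_mult_mat_sum) (auto simp: F2_def K2_def simp del: index_mult_mat(1))
      finally show "(F * Q * (transpose_mat Q * K)) $$ (i, j) = (F2 * K2) $$ (i, j)" .
    qed (auto simp: F2_def K2_def)
    finally have "r \<le> r - 1" by (intro min) (auto simp: F2_def K2_def)
    then show False using r by simp
  qed
  then obtain B where B: "B \<in> carrier_mat r r" "B * G = 1\<^sub>m r"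
    using det_nonzero_inverse[OF G] by metis
  show ?thesis
  proof (rule that)
    show "B * transpose_mat F \<in> carrier_mat r n" using B F by auto
    show "B * transpose_mat F * F = 1\<^sub>m r" using B by (simp add: mult_mat_assoc G_def)
  qed
qed

lemma full_rank_factorization:
  fixes A :: "real mat"
  assumes A: "A \<in> carrier_mat n m"
  obtains r F K F' K' where "F \<in> carrier_mat n r" "K \<in> carrier_mat r m" "A = F * K"
    "F' \<in> carrier_mat r n" "K' \<in> carrier_mat m r" "F' * F = 1\<^sub>m r" "K * K' = 1\<^sub>m r"
proof -
  \<comment> \<open>The least inner dimension of a factorization serves both factors at once: transposing gives the right inverse of \<open>K\<close>.\<close>
  define p where "p s \<longleftrightarrow> (\<exists>F K. F \<in> carrier_mat n s \<and> K \<in> carrier_mat s m \<and> A = F * K)" for s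
  have "p n" unfolding p_def using A by (intro exI[of _ "1\<^sub>m n"] exI[of _ A]) auto
  define r where "r = (LEAST s. p s)"
  have "p r" unfolding r_def using \<open>p n\<close> by (rule LeastI)
  then obtain F K where F: "F \<in> carrier_mat n r" and K: "K \<in> carrier_mat r m" and FK: "A = F * K"
    unfolding p_def by blast
  have min: "r \<le> s" if "F' \<in> carrier_mat n s" "K' \<in> carrier_mat s m" "A = F' * K'" for s F' K'
    unfolding r_def using that by (intro Least_le) (auto simp: p_def)
  obtain F' where F': "F' \<in> carrier_mat r n" "F' * F = 1\<^sub>m r"
    by (rule minimal_factorization_left_inverse[OF F K FK]) (use min in blast)+
  obtain L where L: "L \<in> carrier_mat r m" "L * transpose_mat K = 1\<^sub>m r"
  proof (rule minimal_factorization_left_inverse[of "transpose_mat K" m r "transpose_mat F" n "transpose_mat A"])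
    show "transpose_mat A = transpose_mat K * transpose_mat F"
      unfolding FK by (rule transpose_mult[OF F K])
    show "r \<le> s" if "M \<in> carrier_mat m s" "N \<in> carrier_mat s n" "transpose_mat A = M * N" for s M N
    proof (rule min)
      have "A = transpose_mat (M * N)" using that(3) by (metis transpose_transpose)
      then show "A = transpose_mat N * transpose_mat M" using transpose_mult[OF that(1,2)] by simp
    qed (use that in auto)
  qed (use F K in auto)
  have "K * transpose_mat L = transpose_mat (L * transpose_mat K)"
    using transpose_mult[OF L(1), of "transpose_mat K" r] K by simp
  then have "K * transpose_mat L = 1\<^sub>m r" using L by simp
  then show ?thesis using that[OF F K FK F'(1) _ F'(2), of "transpose_mat L"] L(1) by auto
qed

text \<open>
  A kernel vector of the limit is a limit of kernel vectors as long as the rank does not drop in the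
  limit; the hypothesis \<open>eq\<close> bounds the rank of \<open>L i\<close> by that of \<open>L0\<close>.  A full rank factorization
  \<open>L0 = F * K\<close> induces \<open>L i = Fi * Ki\<close> through the same dimension \<open>r\<close>.  The matrix
  \<open>F' * L i * K' = (F' * Fi) * (Ki * K')\<close> tends to \<open>F' * L0 * K' = 1\<close> and is eventually invertible,
  with inverse \<open>C i\<close>.  Subtracting from \<open>v\<close> the correction \<open>K' * C i * F' * L i * v\<close>, which tends
  to \<open>0\<close>, yields a vector killed by \<open>Ki\<close>.
\<close>

lemma kernel_tendsto:
  assumes L: "mat_tendsto L L0" and L0: "L0 \<in> carrier_mat N N"
    and eq: "\<And>i. \<exists>P P'. P \<in> carrier_mat N N \<and> P' \<in> carrier_mat N N \<and> L i = P * L0 * P'"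
    and v: "v \<in> carrier_mat N 1" "L0 * v = 0\<^sub>m N 1"
  obtains w where "mat_tendsto w v" "\<forall>\<^sub>F i in sequentially. L i * w i = 0\<^sub>m N 1"
proof -
  obtain r F K F' K' where F: "F \<in> carrier_mat N r" and K: "K \<in> carrier_mat r N" and FK: "L0 = F * K"
    and F': "F' \<in> carrier_mat r N" and K': "K' \<in> carrier_mat N r"
    and FF: "F' * F = 1\<^sub>m r" and KK: "K * K' = 1\<^sub>m r"
    using full_rank_factorization[OF L0] by metis
  have [simp]: "dim_row F = N" "dim_col F = r" "dim_row K = r" "dim_col K = N"
    "dim_row F' = r" "dim_col F' = N" "dim_row K' = N" "dim_col K' = r"
    "dim_row L0 = N" "dim_col L0 = N" "dim_row v = N" "dim_col v = 1"
    using F K F' K' L0 v by auto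
  have [simp]: "dim_row (L i) = N" "dim_col (L i) = N" for i
    using mat_tendsto_dim[OF L] by auto
  have "mat_tendsto (\<lambda>i. F' * (L i * K')) (F' * (L0 * K'))"
    by (intro mat_tendsto_mult mat_tendsto_const L) auto
  moreover have "F' * (L0 * K') = 1\<^sub>m r"
    unfolding FK by (simp add: mult_mat_assoc KK FF right_mult_one_mat')
  ultimately have "mat_tendsto (\<lambda>i. F' * (L i * K')) (1\<^sub>m r)" by simp
  then obtain C where C: "mat_tendsto C (1\<^sub>m r)" 
    "\<forall>\<^sub>F i in sequentially. F' * (L i * K') * C i = 1\<^sub>m r \<and> C i * (F' * (L i * K')) = 1\<^sub>m r"
    by (rule inverse_tendsto_one)
  have [simp]: "dim_row (C i) = r" "dim_col (C i) = r" for i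
    using mat_tendsto_dim[OF C(1)] by auto
  define w where "w i = v - K' * (C i * (F' * (L i * v)))" for i
  have "mat_tendsto w (v - K' * (1\<^sub>m r * (F' * (L0 * v))))"
    unfolding w_def by (intro mat_tendsto_minus mat_tendsto_mult mat_tendsto_const L C(1)) auto
  moreover have "v - K' * (1\<^sub>m r * (F' * (L0 * v))) = v"
    unfolding v(2) using v(1) F' K'
    by (intro eq_matI) (auto simp: right_mult_zero_mat[of _ r N] right_mult_zero_mat[of _ N r])
  ultimately have w: "mat_tendsto w v" by simp
  moreover have "\<forall>\<^sub>F i in sequentially. L i * w i = 0\<^sub>m N 1"
    using C(2)
  proof eventually_elim
    case (elim i)
    obtain P P' where P: "P \<in> carrier_mat N N" and P': "P' \<in> carrier_mat N N" and Li: "L i = P * L0 * P'"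
      using eq by blast
    have [simp]: "dim_row P = N" "dim_col P = N" "dim_row P' = N" "dim_col P' = N" using P P' by auto
    define Fi where "Fi = P * F"
    define Ki where "Ki = K * P'"
    have [simp]: "dim_row Fi = N" "dim_col Fi = r" "dim_row Ki = r" "dim_col Ki = N"
      by (auto simp: Fi_def Ki_def)
    have LF: "L i = Fi * Ki" unfolding Li FK Fi_def Ki_def by (simp add: mult_mat_assoc)
    define M where "M = Ki * K'"
    define M' where "M' = F' * Fi"
    have [simp]: "dim_row M = r" "dim_col M = r" "dim_row M' = r" "dim_col M' = r"
      by (auto simp: M_def M'_def)
    have "C i * M' * M = 1\<^sub>m r"
      using elim unfolding LF M_def M'_def by (simp add: mult_mat_assoc)
    then have "M * (C i * M') = 1\<^sub>m r"
      by (intro mat_mult_left_right_inverse[of "C i * M'" r M]) (auto intro: carrier_matI)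
    from mult_mat_cancel[OF this, of "Ki * v"] have "M * (C i * (M' * (Ki * v))) = Ki * v"
      by (simp add: mult_mat_assoc)
    then have "Ki * (K' * (C i * (F' * (L i * v)))) = Ki * v"
      unfolding LF M_def M'_def by (simp add: mult_mat_assoc)
    moreover have "Ki * w i = Ki * v - Ki * (K' * (C i * (F' * (L i * v))))"
      unfolding w_def by (rule mult_minus_distrib_mat[of _ r N _ 1]) (auto intro: carrier_matI)
    ultimately have "Ki * w i = 0\<^sub>m r 1" by (intro eq_matI) auto
    moreover have "dim_row (w i) = N" by (simp add: w_def)
    moreover have "Fi * 0\<^sub>m r 1 = 0\<^sub>m N 1"
      by (rule right_mult_zero_mat[of _ N r]) (auto intro: carrier_matI)
    ultimately show ?case unfolding LF by (simp add: mult_mat_assoc)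
  qed
  ultimately show ?thesis by (rule that)
qed

lemma pair_index_less:
  fixes s t m :: nat
  assumes "s < m" "t < m"
  shows "s * m + t < m * m"
proof -
  have "s * m + t < Suc s * m" using assms by simp
  also have "\<dots> \<le> m * m" using assms by (intro mult_le_mono1) simp
  finally show ?thesis .
qed

lemma sum_nat_pairs:
  fixes f :: "nat \<Rightarrow> real"
  shows "(\<Sum>b<m * m. f b) = (\<Sum>s<m. \<Sum>t<m. f (s * m + t))"
proof -
  have "(\<Sum>s<m. sum f {s * m..<s * m + m}) = (\<Sum>b<m * m. f b)" by (rule sum.nat_group)
  moreover have "sum f {s * m..<s * m + m} = (\<Sum>t<m. f (s * m + t))" for s
    using sum.shift_bounds_nat_ivl[of f 0 "s * m" m] by (simp add: atLeast0LessThan add.commute)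
  ultimately show ?thesis by simp
qed

definition kronecker :: "nat \<Rightarrow> real mat \<Rightarrow> real mat \<Rightarrow> real mat" where
  "kronecker m A B = mat (m * m) (m * m) (\<lambda>(a, b). A $$ (a div m, b div m) * B $$ (a mod m, b mod m))"

definition stack :: "nat \<Rightarrow> real mat \<Rightarrow> real mat" where
  "stack m G = mat (m * m) 1 (\<lambda>(a, _). G $$ (a div m, a mod m))"

lemma div_mod_square: "a < m * m \<Longrightarrow> a div m < m \<and> a mod m < (m::nat)"
  by (cases "m = 0") (auto simp: less_mult_imp_div_less)

lemma kronecker_mult:
  assumes "A \<in> carrier_mat m m" "B \<in> carrier_mat m m" "C \<in> carrier_mat m m" "D \<in> carrier_mat m m"
  shows "kronecker m A B * kronecker m C D = kronecker m (A * C) (B * D)"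
proof (rule eq_matI)
  fix a b assume "a < dim_row (kronecker m (A * C) (B * D))" "b < dim_col (kronecker m (A * C) (B * D))"
  then have ab: "a < m * m" "b < m * m" by (auto simp: kronecker_def)
  note d = div_mod_square[OF ab(1)] div_mod_square[OF ab(2)]
  have "(kronecker m A B * kronecker m C D) $$ (a, b) =
      (\<Sum>c<m * m. kronecker m A B $$ (a, c) * kronecker m C D $$ (c, b))"
    using ab by (subst index_mult_mat_sum) (auto simp: kronecker_def)
  also have "\<dots> = (\<Sum>s<m. \<Sum>t<m. (A $$ (a div m, s) * C $$ (s, b div m)) * (B $$ (a mod m, t) * D $$ (t, b mod m)))"
    unfolding sum_nat_pairs using ab by (intro sum.cong refl) (auto simp: kronecker_def pair_index_less)
  also have "\<dots> = (A * C) $$ (a div m, b div m) * (B * D) $$ (a mod m, b mod m)"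
    using assms d by (simp add: index_mult_mat_sum sum_product del: index_mult_mat(1))
  also have "\<dots> = kronecker m (A * C) (B * D) $$ (a, b)"
    using ab by (simp add: kronecker_def)
  finally show "(kronecker m A B * kronecker m C D) $$ (a, b) = kronecker m (A * C) (B * D) $$ (a, b)" .
qed (auto simp: kronecker_def)

text \<open>
  With matrices \<open>G\<close> written as vectors \<open>stack m G\<close>, the map taking \<open>G\<close> to \<open>A * G * transpose B\<close> is the
  Kronecker product of \<open>A\<close> and \<open>B\<close>.
\<close>

lemma kronecker_stack:
  assumes "A \<in> carrier_mat m m" "B \<in> carrier_mat m m" "G \<in> carrier_mat m m"
  shows "kronecker m A B * stack m G = stack m (A * (G * transpose_mat B))"
proof (rule eq_matI)
  fix a b assume "a < dim_row (stack m (A * (G * transpose_mat B)))" "b < dim_col (stack m (A * (G * transpose_mat B)))"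
  then have ab: "a < m * m" "b = 0" by (auto simp: stack_def)
  note d = div_mod_square[OF ab(1)]
  have "(kronecker m A B * stack m G) $$ (a, b) =
      (\<Sum>c<m * m. kronecker m A B $$ (a, c) * stack m G $$ (c, 0))"
    using ab by (subst index_mult_mat_sum) (auto simp: kronecker_def stack_def)
  also have "\<dots> = (\<Sum>s<m. A $$ (a div m, s) * (\<Sum>t<m. G $$ (s, t) * B $$ (a mod m, t)))"
    unfolding sum_nat_pairs sum_distrib_left using ab
    by (intro sum.cong refl) (auto simp: kronecker_def stack_def pair_index_less)
  also have "\<dots> = (A * (G * transpose_mat B)) $$ (a div m, a mod m)"
    using assms d by (simp add: index_mult_mat_sum del: index_mult_mat(1))
  also have "\<dots> = stack m (A * (G * transpose_mat B)) $$ (a, b)"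
    using ab by (simp add: stack_def)
  finally show "(kronecker m A B * stack m G) $$ (a, b) = stack m (A * (G * transpose_mat B)) $$ (a, b)" .
qed (auto simp: kronecker_def stack_def)

text \<open>
  The condition \<open>H i * G = G * H0\<close> is a homogeneous linear system for \<open>G\<close>, and \<open>G = 1\<close> solves the
  limiting one.  A similarity between \<open>H i\<close> and \<open>H0\<close> turns each system into the limiting one, so all have the
  same rank and \<open>kernel_tendsto\<close> provides solutions tending to \<open>1\<close>.  The given similarities
  themselves need not be close to \<open>1\<close>, nor even bounded.
\<close>

lemma similar_sequence_conjugators:
  assumes H: "mat_tendsto H H0" and H0: "H0 \<in> carrier_mat m m"
    and sim: "\<And>i. \<exists>U V. U \<in> carrier_mat m m \<and> V \<in> carrier_mat m m \<and> U * V = 1\<^sub>m m \<and> V * U = 1\<^sub>m m \<and> H i * U = U * H0"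
  obtains G where "mat_tendsto G (1\<^sub>m m)" "\<forall>\<^sub>F i in sequentially. H i * G i = G i * H0"
proof -
  have Hi: "H i \<in> carrier_mat m m" for i using mat_tendsto_dim[OF H] H0 by auto
  note one = one_carrier_mat[of m]
  define X where "X A = kronecker m A (1\<^sub>m m)" for A
  define Y where "Y = kronecker m (1\<^sub>m m) (transpose_mat H0)"
  define L where "L i = X (H i) - Y" for i
  have [simp]: "dim_row (X A) = m * m" "dim_col (X A) = m * m" "dim_row Y = m * m" "dim_col Y = m * m" for A
    by (auto simp: X_def Y_def kronecker_def)
  have "mat_tendsto (\<lambda>i. X (H i)) (X H0)"
    unfolding mat_tendsto_def
  proof (intro conjI allI impI)
    fix a b assume "a < dim_row (X H0)" "b < dim_col (X H0)"
    then have ab: "a < m * m" "b < m * m" by auto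
    have "(\<lambda>i. H i $$ (a div m, b div m)) \<longlonglongrightarrow> H0 $$ (a div m, b div m)"
      using H H0 div_mod_square[OF ab(1)] div_mod_square[OF ab(2)] unfolding mat_tendsto_def by auto
    then show "(\<lambda>i. X (H i) $$ (a, b)) \<longlonglongrightarrow> X H0 $$ (a, b)"
      using ab by (auto simp: X_def kronecker_def intro!: tendsto_mult)
  qed auto
  then have L: "mat_tendsto L (X H0 - Y)"
    unfolding L_def by (intro mat_tendsto_minus mat_tendsto_const) auto
  have kern: "(X A - Y) * stack m G = stack m (A * G) - stack m (G * H0)"
    if "A \<in> carrier_mat m m" "G \<in> carrier_mat m m" for A G
  proof -
    have "(X A - Y) * stack m G = X A * stack m G - Y * stack m G"
      by (rule minus_mult_distrib_mat[of _ "m * m" "m * m" _ _ 1]) (auto intro: carrier_matI simp: stack_def)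
    then show ?thesis
      using that H0 unfolding X_def Y_def by (subst (asm) (1 2) kronecker_stack) auto
  qed
  obtain w where w: "mat_tendsto w (stack m (1\<^sub>m m))" "\<forall>\<^sub>F i in sequentially. L i * w i = 0\<^sub>m (m * m) 1"
  proof (rule kernel_tendsto[OF L])
    show "X H0 - Y \<in> carrier_mat (m * m) (m * m)" by (auto intro: carrier_matI)
    show "stack m (1\<^sub>m m) \<in> carrier_mat (m * m) 1" by (auto simp: stack_def)
    show "(X H0 - Y) * stack m (1\<^sub>m m) = 0\<^sub>m (m * m) 1"
      using kern[OF H0 one] H0 by (auto intro!: eq_matI simp: stack_def)
    fix i
    obtain U V where U: "U \<in> carrier_mat m m" and V: "V \<in> carrier_mat m m" and UV: "U * V = 1\<^sub>m m"
      and HU: "H i * U = U * H0" using sim by blast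
    have "U * H0 * V = H i * (U * V)"
      using HU U V Hi[of i] H0 by (simp add: mult_mat_assoc flip: HU)
    then have UHV: "U * H0 * V = H i" using UV Hi[of i] by simp
    have "X U * (X H0 - Y) * X V = (X U * X H0 - X U * Y) * X V"
      by (subst mult_minus_distrib_mat[of _ "m * m" "m * m" _ "m * m"]) (auto intro: carrier_matI)
    also have "\<dots> = X U * X H0 * X V - X U * Y * X V"
      by (rule minus_mult_distrib_mat[of _ "m * m" "m * m" _ _ "m * m"]) (auto intro: carrier_matI)
    also have "X U * X H0 * X V = X (H i)"
      using U V H0 unfolding X_def by (simp add: kronecker_mult UHV)
    also have "X U * Y * X V = Y"
      using U V H0 unfolding X_def Y_def by (simp add: kronecker_mult UV)
    finally show "\<exists>P P'. P \<in> carrier_mat (m * m) (m * m) \<and> P' \<in> carrier_mat (m * m) (m * m) \<and>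
        L i = P * (X H0 - Y) * P'"
      unfolding L_def by (intro exI[of _ "X U"] exI[of _ "X V"]) (auto intro: carrier_matI)
  qed
  define G where "G i = mat m m (\<lambda>(p, q). w i $$ (p * m + q, 0))" for i
  have wdim: "dim_row (w i) = m * m" "dim_col (w i) = 1" for i
    using mat_tendsto_dim[OF w(1)] by (auto simp: stack_def)
  have wG: "w i = stack m (G i)" for i
    by (rule eq_matI) (use wdim in \<open>auto simp: stack_def G_def div_mod_square\<close>)
  have "mat_tendsto G (1\<^sub>m m)"
    unfolding mat_tendsto_def
  proof (intro conjI allI impI)
    fix p q assume "p < dim_row (1\<^sub>m m :: real mat)" "q < dim_col (1\<^sub>m m :: real mat)"
    then have pq: "p < m" "q < m" by auto
    have "(\<lambda>i. w i $$ (p * m + q, 0)) \<longlonglongrightarrow> stack m (1\<^sub>m m) $$ (p * m + q, 0)"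
      using w(1) pair_index_less[OF pq] unfolding mat_tendsto_def by (auto simp: stack_def)
    then show "(\<lambda>i. G i $$ (p, q)) \<longlonglongrightarrow> 1\<^sub>m m $$ (p, q)"
      using pq pair_index_less[OF pq] by (simp add: G_def stack_def)
  qed (auto simp: G_def)
  moreover have "\<forall>\<^sub>F i in sequentially. H i * G i = G i * H0"
    using w(2)
  proof eventually_elim
    case (elim i)
    have Gc: "G i \<in> carrier_mat m m" by (simp add: G_def)
    have z: "stack m (H i * G i) - stack m (G i * H0) = 0\<^sub>m (m * m) 1"
      using elim kern[OF Hi Gc] by (simp add: L_def wG)
    show ?case
    proof (rule eq_matI)
      fix p q assume "p < dim_row (G i * H0)" "q < dim_col (G i * H0)"
      then have pq: "p < m" "q < m" using H0 Gc by auto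
      show "(H i * G i) $$ (p, q) = (G i * H0) $$ (p, q)"
        using arg_cong[OF z, of "\<lambda>M. M $$ (p * m + q, 0)"] pair_index_less[OF pq] pq
        by (simp add: stack_def del: index_mult_mat(1))
    qed (use Hi[of i] Gc H0 in auto)
  qed
  ultimately show ?thesis by (rule that)
qed

section \<open>Shift equivalent matrices near a positive matrix\<close>

text \<open>
  Replace rows \<open>0, \<dots>, k - 1\<close> of \<open>P\<close> by those of \<open>P'\<close> in this order.  The change in row \<open>l\<close> is a row vector
  supported to the right of column \<open>l\<close>, times the unit column \<open>l\<close>.  Since the first columns are strictly
  upper triangular, the iterated images of that unit column are supported on \<open>{0..l}\<close> and become \<open>0\<close>
  after \<open>l + 1\<close> steps; so this is a nilpotent rank-one update.
\<close>

lemma sse_row_updates: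
  assumes Q: "Q \<in> carrier_mat n n" and Q': "Q' \<in> carrier_mat n n" and Q'Q: "Q' * Q = 1\<^sub>m n"
    and P: "P \<in> carrier_mat n n" and P': "P' \<in> carrier_mat n n" and k: "k \<le> n"
    and su: "strictly_upper_columns k P" and su': "strictly_upper_columns k P'"
    and agree: "\<And>i j. k \<le> i \<Longrightarrow> i < n \<Longrightarrow> j < n \<Longrightarrow> P $$ (i, j) = P' $$ (i, j)"
    and pos: "\<And>l. l \<le> k \<Longrightarrow> positive_matrix (Q * mat n n (\<lambda>(i, j). if i < l then P' $$ (i, j) else P $$ (i, j)) * Q')"
  shows "sse (Q * P * Q') (Q * P' * Q')"
proof -
  have [simp]: "dim_row Q = n" "dim_col Q = n" "dim_row Q' = n" "dim_col Q' = n"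
    "dim_row P = n" "dim_col P = n" "dim_row P' = n" "dim_col P' = n"
    using Q Q' P P' by auto
  define M where "M l = mat n n (\<lambda>(i, j). if i < l then P' $$ (i, j) else P $$ (i, j))" for l
  have [simp]: "dim_row (M l) = n" "dim_col (M l) = n" for l by (auto simp: M_def)
  have suM: "M l $$ (i, j) = 0" if "j < k" "j \<le> i" "i < n" for l i j
    using su su' that unfolding strictly_upper_columns_def M_def by auto
  have step: "sse (Q * M l * Q') (Q * M (Suc l) * Q')" if l: "l < k" for l
  proof -
    define u where "u = rec_nat (mat n 1 (\<lambda>(i, _). if i = l then 1 else 0)) (\<lambda>_ v. M l * v)"
    have u0: "u 0 = mat n 1 (\<lambda>(i, _). if i = l then 1 else 0)" and uS: "u (Suc r) = M l * u r" for r
      by (auto simp: u_def)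
    have [simp]: "dim_row (u r) = n" "dim_col (u r) = 1" for r
      by (induction r) (auto simp: u0 uS)
    have supp: "u r $$ (i, 0) = 0" if "i < n" "l < i + r" for r i
      using that
    proof (induction r arbitrary: i)
      case (Suc r)
      have "u (Suc r) $$ (i, 0) = (\<Sum>j<n. M l $$ (i, j) * u r $$ (j, 0))"
        unfolding uS using Suc.prems by (subst index_mult_mat_sum) auto
      also have "\<dots> = 0"
      proof (intro sum.neutral ballI)
        fix j assume j: "j \<in> {..<n}"
        show "M l $$ (i, j) * u r $$ (j, 0) = 0"
        proof (cases "l < j + r")
          case False
          then show ?thesis using suM[of j i l] Suc.prems l by simp
        qed (use Suc.IH[of j] j in simp)
      qed
      finally show ?case .
    qed (simp add: u0)
    define d where "d = mat 1 n (\<lambda>(_, j). P $$ (l, j) - P' $$ (l, j))"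
    have [simp]: "dim_row d = 1" "dim_col d = n" by (auto simp: d_def)
    have d0: "d $$ (0, j) = 0" if "j \<le> l" for j
      using su su' that l k unfolding d_def strictly_upper_columns_def by auto
    have du: "d * u r = 0\<^sub>m 1 1" for r
    proof (rule eq_matI)
      fix i j assume "i < dim_row (0\<^sub>m 1 1 :: real mat)" "j < dim_col (0\<^sub>m 1 1 :: real mat)"
      then have ij: "i = 0" "j = 0" by auto
      have "(d * u r) $$ (0, 0) = (\<Sum>j<n. d $$ (0, j) * u r $$ (j, 0))"
        by (subst index_mult_mat_sum) auto
      also have "\<dots> = 0"
        using d0 supp[of _ r] by (intro sum.neutral ballI)
          (metis lessThan_iff linorder_not_less mult_eq_0_iff trans_less_add1)
      finally show "(d * u r) $$ (i, j) = 0\<^sub>m 1 1 $$ (i, j)" using ij by simp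
    qed auto
    have Mud: "M l - u 0 * d = M (Suc l)"
    proof (rule eq_matI)
      fix i j assume "i < dim_row (M (Suc l))" "j < dim_col (M (Suc l))"
      then have ij: "i < n" "j < n" by auto
      have "(u 0 * d) $$ (i, j) = (if i = l then P $$ (l, j) - P' $$ (l, j) else 0)"
        using ij by (subst index_mult_mat_sum) (auto simp: u0 d_def)
      then show "(M l - u 0 * d) $$ (i, j) = M (Suc l) $$ (i, j)"
        using ij by (auto simp: M_def simp del: index_mult_mat(1))
    qed auto
    have "Q * M l * Q' - Q * (u 0 * d) * Q' = (Q * M l - Q * (u 0 * d)) * Q'"
      by (rule minus_mult_distrib_mat[symmetric, of _ n n _ _ n]) (auto intro: carrier_matI)
    also have "Q * M l - Q * (u 0 * d) = Q * (M l - u 0 * d)"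
      by (rule mult_minus_distrib_mat[symmetric, of _ n n _ n]) (auto intro: carrier_matI)
    finally have upd: "Q * M l * Q' - (Q * u 0) * (d * Q') = Q * M (Suc l) * Q'"
      unfolding Mud by (simp add: mult_mat_assoc)
    have "sse (Q * M l * Q') (Q * M l * Q' - (Q * u 0) * (d * Q'))"
    proof (rule sse_rank_one_update[where x = "\<lambda>r. Q * u r" and m = "Suc l" and n = n])
      show "positive_matrix (Q * M l * Q')" "positive_matrix (Q * M l * Q' - (Q * u 0) * (d * Q'))"
        using pos[of l, folded M_def] pos[of "Suc l", folded M_def] l unfolding upd by auto
      show "Q * M l * Q' * (Q * u r) = Q * u (Suc r)" for r
        by (simp add: mult_mat_assoc mult_mat_cancel[OF Q'Q] uS)
      show "d * Q' * (Q * u r) = 0\<^sub>m 1 1" for r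
        by (simp add: mult_mat_assoc mult_mat_cancel[OF Q'Q] du)
      have "u (Suc l) = 0\<^sub>m n 1"
        by (rule eq_matI) (use supp[of _ "Suc l"] in auto)
      then show "Q * u (Suc l) = 0\<^sub>m n 1" using Q by simp
    qed (auto intro: carrier_matI)
    then show ?thesis unfolding upd .
  qed
  have "sse (Q * M 0 * Q') (Q * M l * Q')" if "l \<le> k" for l
    using that
  proof (induction l)
    case (Suc l)
    then show ?case using step[of l] by (meson Suc_le_lessD less_imp_le sse_trans)
  qed simp
  moreover have "M 0 = P" by (rule eq_matI) (auto simp: M_def)
  moreover have "M k = P'" by (rule eq_matI) (use agree in \<open>auto simp: M_def\<close>)
  ultimately show ?thesis by force
qed

text \<open>
  The block diagonal matrix \<open>diag(1, G)\<close> whose first block is the identity of size \<open>k\<close>.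
\<close>

definition extend_identity :: "nat \<Rightarrow> nat \<Rightarrow> real mat \<Rightarrow> real mat" where
  "extend_identity n k G = mat n n (\<lambda>(i, j). if i < k \<or> j < k then (if i = j then 1 else 0) else G $$ (i - k, j - k))"

lemma extend_identity_dim [simp]:
  "dim_row (extend_identity n k G) = n" "dim_col (extend_identity n k G) = n"
  by (auto simp: extend_identity_def)

lemma extend_identity_lower_left:
  "k \<le> i \<Longrightarrow> i < n \<Longrightarrow> j < k \<Longrightarrow> k \<le> n \<Longrightarrow> extend_identity n k G $$ (i, j) = 0"
  by (auto simp: extend_identity_def)

lemma lower_block_extend_identity:
  "G \<in> carrier_mat (n - k) (n - k) \<Longrightarrow> lower_block k (extend_identity n k G) = G"
  by (rule eq_matI) (auto simp: lower_block_def extend_identity_def)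

lemma extend_identity_mult_row:
  assumes "k \<le> n" "dim_row P = n" "i < k" "j < dim_col P"
  shows "(extend_identity n k G * P) $$ (i, j) = P $$ (i, j)"
  using assms by (subst index_mult_mat_sum)
    (auto simp: extend_identity_def if_distrib[of "\<lambda>c. c * _"] cong: if_cong)

lemma extend_identity_mult_col:
  assumes "k \<le> n" "dim_col P = n" "j < k" "i < dim_row P"
  shows "(P * extend_identity n k G) $$ (i, j) = P $$ (i, j)"
  using assms by (subst index_mult_mat_sum)
    (auto simp: extend_identity_def if_distrib[of "\<lambda>c. _ * c"] cong: if_cong)

lemma extend_identity_product:
  assumes k: "k \<le> n" and G: "G \<in> carrier_mat (n - k) (n - k)" and Y: "Y \<in> carrier_mat (n - k) (n - k)"
  shows "extend_identity n k G * extend_identity n k Y = extend_identity n k (G * Y)"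
proof (rule eq_matI)
  let ?E = "extend_identity n k"
  fix i j assume "i < dim_row (?E (G * Y))" "j < dim_col (?E (G * Y))"
  then have ij: "i < n" "j < n" by auto
  consider "i < k" | "j < k" | "k \<le> i" "k \<le> j" by linarith
  then show "(?E G * ?E Y) $$ (i, j) = ?E (G * Y) $$ (i, j)"
  proof cases
    case 1
    have "(?E G * ?E Y) $$ (i, j) = ?E Y $$ (i, j)"
      using 1 ij k by (intro extend_identity_mult_row) auto
    then show ?thesis using 1 ij by (simp add: extend_identity_def del: index_mult_mat(1))
  next
    case 2
    have "(?E G * ?E Y) $$ (i, j) = ?E G $$ (i, j)"
      using 2 ij k by (intro extend_identity_mult_col) auto
    then show ?thesis using 2 ij by (simp add: extend_identity_def del: index_mult_mat(1))
  next
    case 3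
    have "lower_block k (?E G * ?E Y) = G * Y"
      using k extend_identity_lower_left[of k _ n _ G]
      by (subst lower_block_mult[of _ n])
        (auto simp: lower_block_extend_identity[OF G] lower_block_extend_identity[OF Y] intro: carrier_matI)
    then have "lower_block k (?E G * ?E Y) $$ (i - k, j - k) = (G * Y) $$ (i - k, j - k)" by simp
    then show ?thesis using 3 ij
      by (simp add: lower_block_def extend_identity_def del: index_mult_mat(1))
  qed
qed auto

lemma extend_identity_one: "extend_identity n k (1\<^sub>m (n - k)) = 1\<^sub>m n"
  by (rule eq_matI) (auto simp: extend_identity_def)

lemma mat_tendsto_extend_identity:
  assumes "mat_tendsto G (1\<^sub>m (n - k))"
  shows "mat_tendsto (\<lambda>i. extend_identity n k (G i)) (1\<^sub>m n)"
  unfolding mat_tendsto_def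
proof (intro conjI allI impI)
  fix a b assume "a < dim_row (1\<^sub>m n :: real mat)" "b < dim_col (1\<^sub>m n :: real mat)"
  then have ab: "a < n" "b < n" by auto
  show "(\<lambda>i. extend_identity n k (G i) $$ (a, b)) \<longlonglongrightarrow> 1\<^sub>m n $$ (a, b)"
  proof (cases "a < k \<or> b < k")
    case True
    then show ?thesis using ab by (simp add: extend_identity_def)
  next
    case False
    then have "a - k < n - k" "b - k < n - k" using ab by auto
    then have "(\<lambda>i. G i $$ (a - k, b - k)) \<longlonglongrightarrow> 1\<^sub>m (n - k) $$ (a - k, b - k)"
      using assms unfolding mat_tendsto_def by (simp del: index_one_mat(1))
    moreover have "(a - k = b - k) = (a = b)" using False by auto
    ultimately show ?thesis using False ab \<open>a - k < n - k\<close> \<open>b - k < n - k\<close>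
      by (simp add: extend_identity_def)
  qed
qed (auto simp: extend_identity_def)

text \<open>
  Here \<open>P i\<close> and \<open>P0\<close> are the block forms of \<open>a i\<close> and \<open>L\<close>, with lower blocks \<open>H i\<close> and \<open>H0\<close>, and \<open>P' i\<close>
  is \<open>P i\<close> with its lower block conjugated to \<open>H0\<close>.  The passage from \<open>a i\<close> to
  \<open>Q0 * P' i * transpose Q0\<close> is a conjugation by \<open>F i\<close>, which tends to the identity; the
  passage on to \<open>L = Q0 * P0 * transpose Q0\<close> changes only the first \<open>k\<close> rows of \<open>P' i\<close>.
\<close>

lemma eventually_sse_limit:
  assumes a: "mat_tendsto a L" and L: "L \<in> carrier_mat n n" "positive_matrix L"
    and SE: "\<And>i. shift_equivalent_over UNIV (a i) L"
    and Q: "mat_tendsto Q Q0" and Qi: "\<And>i. orthonormal_mat n (Q i)" and k: "k \<le> n"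
    and su: "\<And>i. strictly_upper_columns k (transpose_mat (Q i) * a i * Q i)"
    and dt: "\<And>i. Determinant.det (lower_block k (transpose_mat (Q i) * a i * Q i)) \<noteq> 0"
  shows "\<forall>\<^sub>F i in sequentially. sse (a i) L"
proof -
  have [simp]: "dim_row (Q i) = n" "dim_col (Q i) = n" for i
    using Qi[of i] by (auto simp: orthonormal_mat_def)
  have [simp]: "dim_row Q0 = n" "dim_col Q0 = n"
    using mat_tendsto_dim[OF Q, of 0] by auto
  have [simp]: "dim_row L = n" "dim_col L = n" "dim_row (a i) = n" "dim_col (a i) = n" for i
    using L mat_tendsto_dim[OF a] by auto
  have ai: "a i \<in> carrier_mat n n" for i by (auto intro: carrier_matI)
  have Qt: "mat_tendsto (\<lambda>i. transpose_mat (Q i)) (transpose_mat Q0)"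
    by (rule mat_tendsto_transpose[OF Q])
  have QQi: "Q i * transpose_mat (Q i) = 1\<^sub>m n" "transpose_mat (Q i) * Q i = 1\<^sub>m n" for i
    using Qi by (auto simp: orthonormal_mat_def)
  have "mat_tendsto (\<lambda>i. Q i * transpose_mat (Q i)) (Q0 * transpose_mat Q0)"
    "mat_tendsto (\<lambda>i. transpose_mat (Q i) * Q i) (transpose_mat Q0 * Q0)"
    by (intro mat_tendsto_mult Q Qt; simp)+
  then have QQ0: "Q0 * transpose_mat Q0 = 1\<^sub>m n" "transpose_mat Q0 * Q0 = 1\<^sub>m n"
    unfolding QQi by (auto dest: mat_tendsto_unique[OF mat_tendsto_const])
  then have Q0: "orthonormal_mat n Q0" by (auto simp: orthonormal_mat_def intro: carrier_matI)
  define P where "P i = transpose_mat (Q i) * a i * Q i" for i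
  define P0 where "P0 = transpose_mat Q0 * L * Q0"
  have [simp]: "dim_row (P i) = n" "dim_col (P i) = n" "dim_row P0 = n" "dim_col P0 = n" for i
    by (auto simp: P_def P0_def)
  have Pc: "P i \<in> carrier_mat n n" "P0 \<in> carrier_mat n n" for i by (auto intro: carrier_matI)
  have P: "mat_tendsto P P0"
    unfolding P_def P0_def by (intro mat_tendsto_mult Q Qt a) auto
  have suP: "P i $$ (c, b) = 0" if "b < k" "b \<le> c" "c < n" for i b c
    using su[of i, folded P_def] that unfolding strictly_upper_columns_def by auto
  have suP0: "strictly_upper_columns k P0"
    unfolding strictly_upper_columns_def
  proof (intro allI impI)
    fix b c assume bc: "b < k" "b \<le> c" "c < dim_row P0"
    then have "(\<lambda>i. P i $$ (c, b)) \<longlonglongrightarrow> P0 $$ (c, b)"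
      using P k unfolding mat_tendsto_def by auto
    then show "P0 $$ (c, b) = 0"
      using suP[of b c] bc by (auto dest: LIMSEQ_unique[OF tendsto_const])
  qed
  define H where "H i = lower_block k (P i)" for i
  define H0 where "H0 = lower_block k P0"
  have Hc: "H i \<in> carrier_mat (n - k) (n - k)" "H0 \<in> carrier_mat (n - k) (n - k)" for i
    unfolding H_def H0_def using Pc by (auto intro: lower_block_carrier)
  have H: "mat_tendsto H H0"
    unfolding H_def H0_def by (rule mat_tendsto_lower_block[OF P])
  have sim: "\<exists>U V. U \<in> carrier_mat (n - k) (n - k) \<and> V \<in> carrier_mat (n - k) (n - k) \<and>
      U * V = 1\<^sub>m (n - k) \<and> V * U = 1\<^sub>m (n - k) \<and> H i * U = U * H0" for i
    unfolding H_def H0_def P_def P0_def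
    using shift_equivalent_conjugate_lower_blocks[OF ai L(1) SE Qi Q0 k su suP0[unfolded P0_def] dt]
    by metis
  obtain G where G: "mat_tendsto G (1\<^sub>m (n - k))" and HG: "\<forall>\<^sub>F i in sequentially. H i * G i = G i * H0"
    using similar_sequence_conjugators[OF H Hc(2) sim] by blast
  obtain Y where Y: "mat_tendsto Y (1\<^sub>m (n - k))"
    and GY: "\<forall>\<^sub>F i in sequentially. G i * Y i = 1\<^sub>m (n - k) \<and> Y i * G i = 1\<^sub>m (n - k)"
    using inverse_tendsto_one[OF G] by blast
  have Gc: "G i \<in> carrier_mat (n - k) (n - k)" and Yc: "Y i \<in> carrier_mat (n - k) (n - k)" for i
    using mat_tendsto_dim[OF G] mat_tendsto_dim[OF Y] by auto
  define E where "E = extend_identity n k"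
  have [simp]: "dim_row (E X) = n" "dim_col (E X) = n" for X
    by (auto simp: E_def extend_identity_def)
  have tG: "mat_tendsto (\<lambda>i. E (G i)) (1\<^sub>m n)" and tY: "mat_tendsto (\<lambda>i. E (Y i)) (1\<^sub>m n)"
    unfolding E_def by (intro mat_tendsto_extend_identity G Y)+
  define P' where "P' i = E (Y i) * (P i * E (G i))" for i
  have [simp]: "dim_row (P' i) = n" "dim_col (P' i) = n" for i by (auto simp: P'_def)
  have P'c: "P' i \<in> carrier_mat n n" for i by (auto intro: carrier_matI)
  have "mat_tendsto P' (1\<^sub>m n * (P0 * 1\<^sub>m n))"
    unfolding P'_def by (intro mat_tendsto_mult tG tY P) auto
  then have P': "mat_tendsto P' P0" using Pc by simp
  have PEc: "P i * E (G i) \<in> carrier_mat n n" for i by (auto intro: carrier_matI)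
  have PE: "(P i * E (G i)) $$ (c, b) = P i $$ (c, b)" if "b < k" "c < n" for i b c
    unfolding E_def using that k by (intro extend_identity_mult_col) auto
  have suP': "strictly_upper_columns k (P' i)" for i
    unfolding strictly_upper_columns_def
  proof (intro allI impI)
    fix b c assume "b < k" "b \<le> c" "c < dim_row (P' i)"
    then have bc: "b < k" "b \<le> c" "c < n" "b < n" using k by auto
    show "P' i $$ (c, b) = 0"
    proof (cases "c < k")
      case True
      then have "P' i $$ (c, b) = (P i * E (G i)) $$ (c, b)"
        unfolding P'_def E_def using bc True k by (intro extend_identity_mult_row) auto
      then show ?thesis using PE[OF bc(1,3)] suP[OF bc(1-3)] by (simp del: index_mult_mat(1))
    next
      case False
      have "P' i $$ (c, b) = (\<Sum>l<n. E (Y i) $$ (c, l) * (P i * E (G i)) $$ (l, b))"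
        unfolding P'_def using bc by (subst index_mult_mat_sum) auto
      also have "\<dots> = 0"
      proof (intro sum.neutral ballI)
        fix l assume l: "l \<in> {..<n}"
        show "E (Y i) $$ (c, l) * (P i * E (G i)) $$ (l, b) = 0"
        proof (cases "l < k")
          case True
          then show ?thesis using extend_identity_lower_left[of k c n l "Y i"] False bc k by (simp add: E_def)
        next
          case False
          then show ?thesis using PE[of b l i] suP[of b l i] bc l by (simp del: index_mult_mat(1))
        qed
      qed
      finally show ?thesis .
    qed
  qed
  define F where "F i = Q i * (E (G i) * transpose_mat Q0)" for i
  define F' where "F' i = Q0 * (E (Y i) * transpose_mat (Q i))" for i
  have "mat_tendsto F (Q0 * (1\<^sub>m n * transpose_mat Q0))" "mat_tendsto F' (Q0 * (1\<^sub>m n * transpose_mat Q0))"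
    unfolding F_def F'_def by (intro mat_tendsto_mult mat_tendsto_const Q Qt tG tY; simp)+
  then have F: "mat_tendsto F (1\<^sub>m n)" and F': "mat_tendsto F' (1\<^sub>m n)"
    using QQ0 by (auto simp: left_mult_one_mat')
  have EGY: "E (G i) * E (Y i) = 1\<^sub>m n" if "G i * Y i = 1\<^sub>m (n - k)" for i
    unfolding E_def extend_identity_product[OF k Gc Yc] that by (rule extend_identity_one)
  have FF': "\<forall>\<^sub>F i in sequentially. F i * F' i = 1\<^sub>m n"
    using GY
  proof eventually_elim
    case (elim i)
    have "F i * F' i = Q i * (E (G i) * (transpose_mat Q0 * (Q0 * (E (Y i) * transpose_mat (Q i)))))"
      by (simp add: F_def F'_def mult_mat_assoc)
    also have "\<dots> = 1\<^sub>m n"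
      using elim by (simp add: mult_mat_cancel[OF QQ0(2)] mult_mat_cancel[OF EGY] QQi)
    finally show ?case .
  qed
  \<comment> \<open>The intermediate matrices of the row updates; each sequence has limit \<open>P0\<close>, so finitely many are eventually positive together.\<close>
  define M where "M i l = mat n n (\<lambda>(b, c). if b < l then P0 $$ (b, c) else P' i $$ (b, c))" for i l
  have "mat_tendsto (\<lambda>i. M i l) P0" for l
    unfolding mat_tendsto_def
  proof (intro conjI allI impI)
    fix b c assume bc: "b < dim_row P0" "c < dim_col P0"
    then show "(\<lambda>i. M i l $$ (b, c)) \<longlonglongrightarrow> P0 $$ (b, c)"
      using P' unfolding mat_tendsto_def by (cases "b < l") (auto simp: M_def)
  qed (auto simp: M_def)
  then have "mat_tendsto (\<lambda>i. Q0 * M i l * transpose_mat Q0) (Q0 * P0 * transpose_mat Q0)" for l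
    by (intro mat_tendsto_mult mat_tendsto_const) auto
  moreover have QPQ: "Q0 * P0 * transpose_mat Q0 = L"
    unfolding P0_def by (simp add: mult_mat_assoc mult_mat_cancel[OF QQ0(1)] QQ0(1) right_mult_one_mat')
  ultimately have "\<forall>\<^sub>F i in sequentially. \<forall>l\<in>{..k}. positive_matrix (Q0 * M i l * transpose_mat Q0)"
    using L(2) by (intro eventually_ball_finite ballI eventually_positive_matrix[where L = L]) auto
  then show ?thesis
    using eventually_sse_conjugate[OF a L F F' FF'] HG GY
  proof eventually_elim
    case (elim i)
    have "F' i * a i * F i = Q0 * P' i * transpose_mat Q0"
      unfolding F_def F'_def P'_def P_def by (simp add: mult_mat_assoc)
    moreover have "sse (Q0 * P' i * transpose_mat Q0) (Q0 * P0 * transpose_mat Q0)"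
    proof (rule sse_row_updates[OF _ _ QQ0(2) P'c Pc(2) k suP' suP0])
      have "lower_block k (P' i) = lower_block k (E (Y i)) * lower_block k (P i * E (G i))"
        unfolding P'_def E_def using k
        by (intro lower_block_mult[of _ n] PEc[unfolded E_def] k extend_identity_lower_left) (auto intro: carrier_matI)
      also have "lower_block k (P i * E (G i)) = H i * G i"
        unfolding H_def E_def using suP
        by (subst lower_block_mult[of _ n]) (auto simp: lower_block_extend_identity[OF Gc] k intro: carrier_matI)
      also have "lower_block k (E (Y i)) = Y i" unfolding E_def by (rule lower_block_extend_identity[OF Yc])
      also have "H i * G i = G i * H0" using elim by simp
      also have "Y i * (G i * H0) = H0"
        using elim Gc[of i] Yc[of i] Hc by (intro mult_mat_cancel) auto
      finally have lb: "lower_block k (P' i) = lower_block k P0" by (simp add: H0_def)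
      show "P' i $$ (b, c) = P0 $$ (b, c)" if "k \<le> b" "b < n" "c < n" for b c
      proof (cases "c < k")
        case True
        then show ?thesis using suP' suP0 that unfolding strictly_upper_columns_def by auto
      next
        case False
        then show ?thesis
          using arg_cong[OF lb, of "\<lambda>X. X $$ (b - k, c - k)"] that by (simp add: lower_block_def)
      qed
      show "positive_matrix (Q0 * mat n n (\<lambda>(b, c). if b < l then P0 $$ (b, c) else P' i $$ (b, c)) * transpose_mat Q0)"
        if "l \<le> k" for l
        using elim(1) that unfolding M_def by blast
    qed (auto intro: carrier_matI)
    ultimately show ?case using elim(2) QPQ by (metis sse_trans)
  qed
qed

lemma finite_convergent_subsequence:
  fixes f :: "nat \<Rightarrow> 'i \<Rightarrow> real"
  assumes "finite I" "\<And>x i. x \<in> I \<Longrightarrow> \<bar>f i x\<bar> \<le> c"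
  shows "\<exists>r l. strict_mono (r :: nat \<Rightarrow> nat) \<and> (\<forall>x\<in>I. (\<lambda>i. f (r i) x) \<longlonglongrightarrow> l x)"
  using assms
proof (induction I rule: finite_induct)
  case empty
  show ?case by (intro exI[of _ "\<lambda>i. i"]) (auto simp: strict_mono_def)
next
  case (insert y I)
  then obtain r l where r: "strict_mono (r :: nat \<Rightarrow> nat)" and l: "\<And>x. x \<in> I \<Longrightarrow> (\<lambda>i. f (r i) x) \<longlonglongrightarrow> l x"
    using insert.IH insert.prems by blast
  have "bounded (range (\<lambda>i. f (r i) y))"
    using insert.prems[of y] by (auto simp: bounded_iff)
  then obtain m s where s: "strict_mono (s :: nat \<Rightarrow> nat)" and m: "(\<lambda>i. f (r (s i)) y) \<longlonglongrightarrow> m"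
    using bounded_imp_convergent_subsequence unfolding comp_def by blast
  have "(\<lambda>i. f (r (s i)) x) \<longlonglongrightarrow> l x" if "x \<in> I" for x
    using LIMSEQ_subseq_LIMSEQ[OF l[OF that] s] by (simp add: comp_def)
  then show ?case
    using m strict_mono_o[OF r s] insert.hyps
    by (intro exI[of _ "\<lambda>i. r (s i)"] exI[of _ "l(y := m)"]) (auto simp: comp_def)
qed

lemma orthonormal_mat_entry_bound:
  assumes Q: "orthonormal_mat n Q" and ij: "i < n" "j < n"
  shows "\<bar>Q $$ (i, j)\<bar> \<le> 1"
proof -
  have [simp]: "dim_row Q = n" "dim_col Q = n" using Q by (auto simp: orthonormal_mat_def)
  have "(Q * transpose_mat Q) $$ (i, i) = (\<Sum>l<n. (Q $$ (i, l))\<^sup>2)"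
    using ij by (subst index_mult_mat_sum) (auto simp: power2_eq_square)
  moreover have "Q * transpose_mat Q = 1\<^sub>m n" using Q by (simp add: orthonormal_mat_def)
  ultimately have "(\<Sum>l<n. (Q $$ (i, l))\<^sup>2) = 1"
    using ij by (simp del: index_mult_mat(1))
  moreover have "(Q $$ (i, j))\<^sup>2 \<le> (\<Sum>l<n. (Q $$ (i, l))\<^sup>2)"
    using ij by (intro member_le_sum) auto
  ultimately show ?thesis by (simp add: abs_square_le_1)
qed

lemma orthogonal_convergent_subsequence:
  assumes "\<And>i. orthonormal_mat n (Q i)"
  obtains r Q0 where "strict_mono (r :: nat \<Rightarrow> nat)" "mat_tendsto (\<lambda>i. Q (r i)) Q0"
proof -
  have "\<exists>r l. strict_mono (r :: nat \<Rightarrow> nat) \<and> (\<forall>x\<in>{..<n} \<times> {..<n}. (\<lambda>i. Q (r i) $$ x) \<longlonglongrightarrow> l x)"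
    using orthonormal_mat_entry_bound[OF assms]
    by (intro finite_convergent_subsequence[of _ "\<lambda>i x. Q i $$ x" 1]) auto
  then obtain r l where r: "strict_mono (r :: nat \<Rightarrow> nat)"
    and l: "\<And>x. x \<in> {..<n} \<times> {..<n} \<Longrightarrow> (\<lambda>i. Q (r i) $$ x) \<longlonglongrightarrow> l x" by blast
  have "mat_tendsto (\<lambda>i. Q (r i)) (mat n n l)"
    using l assms unfolding mat_tendsto_def by (auto simp: orthonormal_mat_def)
  with r show ?thesis by (rule that)
qed

text \<open>
  The sizes of the nilpotent blocks take finitely many values and the orthogonal matrices have bounded
  entries, so some subsequence has a constant size and convergent orthogonal matrices.
\<close>

lemma sse_frequently_limit:
  assumes a: "mat_tendsto a L" and L: "L \<in> carrier_mat n n" "positive_matrix L"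
    and SE: "\<And>i. shift_equivalent_over UNIV (a i) L"
  shows "\<exists>i. sse (a i) L"
proof -
  have ai: "a i \<in> carrier_mat n n" for i using mat_tendsto_dim[OF a, of i] L by auto
  obtain Q k where Q: "\<And>i. orthonormal_mat n (Q i)" and k: "\<And>i. k i \<le> n"
    and su: "\<And>i. strictly_upper_columns (k i) (transpose_mat (Q i) * a i * Q i)"
    and dt: "\<And>i. Determinant.det (lower_block (k i) (transpose_mat (Q i) * a i * Q i)) \<noteq> 0"
    using orthogonal_kernel_deflation[OF ai] by metis
  have "finite (range k)" by (rule finite_subset[of _ "{..n}"]) (use k in auto)
  then obtain i0 where inf: "infinite {i. k i = k i0}"
    using pigeonhole_infinite[of UNIV k] by auto
  define r where "r = enumerate {i. k i = k i0}"
  have r: "strict_mono r" unfolding r_def by (rule strict_mono_enumerate[OF inf])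
  have kr: "k (r i) = k i0" for i
    using enumerate_in_set[OF inf] by (simp add: r_def)
  obtain s Q0 where s: "strict_mono s" and Q0: "mat_tendsto (\<lambda>i. Q (r (s i))) Q0"
    using orthogonal_convergent_subsequence[of n "\<lambda>i. Q (r i)"] Q by blast
  have rs: "strict_mono (\<lambda>i. r (s i))" using strict_mono_o[OF r s] by (simp add: comp_def)
  have "\<forall>\<^sub>F i in sequentially. sse (a (r (s i))) L"
  proof (rule eventually_sse_limit[OF mat_tendsto_subseq[OF a rs] L _ Q0])
    show "k i0 \<le> n" by (rule k)
    show "strictly_upper_columns (k i0) (transpose_mat (Q (r (s i))) * a (r (s i)) * Q (r (s i)))" for i
      using su[of "r (s i)"] unfolding kr .
    show "Determinant.det (lower_block (k i0) (transpose_mat (Q (r (s i))) * a (r (s i)) * Q (r (s i)))) \<noteq> 0" for i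
      using dt[of "r (s i)"] unfolding kr .
  qed (use SE Q in auto)
  then show ?thesis using eventually_happens'[OF sequentially_bot] by blast
qed

theorem theorem7p5:
  fixes n :: nat and A :: "real \<Rightarrow> real mat"
  assumes "matrix_path n A"
    and "\<And>t. t \<in> {0..1} \<Longrightarrow> positive_matrix (A t)"
    and "\<And>s t. s \<in> {0..1} \<Longrightarrow> t \<in> {0..1} \<Longrightarrow> shift_equivalent_over UNIV (A s) (A t)"
  shows "strong_shift_equivalent_over {0..} (A 0) (A 1)"
proof -
  have A: "A t \<in> carrier_mat n n" if "t \<in> {0..1}" for t
    using assms(1) that unfolding matrix_path_def by blast
  have cont: "continuous_on {0..1} (\<lambda>t. A t $$ (i, j))" if "i < n" "j < n" for i j
    using assms(1) that unfolding matrix_path_def by blast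
  have local: "\<exists>d>0. \<forall>s\<in>{0..1}. \<bar>s - t\<bar> < d \<longrightarrow> sse (A s) (A t)" if t: "t \<in> {0..1}" for t
  proof (rule ccontr)
    assume "\<not> ?thesis"
    then have "\<exists>s\<in>{0..1}. \<bar>s - t\<bar> < 1 / real (Suc i) \<and> \<not> sse (A s) (A t)" for i
      by (metis of_nat_0_less_iff zero_less_Suc zero_less_divide_1_iff)
    then obtain s where s: "\<And>i. s i \<in> {0..1}" and st: "\<And>i. \<bar>s i - t\<bar> < 1 / real (Suc i)"
      and ns: "\<And>i. \<not> sse (A (s i)) (A t)" by metis
    have "(\<lambda>i. s i - t) \<longlonglongrightarrow> 0"
      by (rule LIMSEQ_norm_0) (use st in \<open>simp add: less_imp_le\<close>)
    then have lim: "s \<longlonglongrightarrow> t" by (rule LIM_zero_cancel)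
    have "mat_tendsto (\<lambda>i. A (s i)) (A t)"
      unfolding mat_tendsto_def
    proof (intro conjI allI impI)
      fix a b assume "a < dim_row (A t)" "b < dim_col (A t)"
      then show "(\<lambda>i. A (s i) $$ (a, b)) \<longlonglongrightarrow> A t $$ (a, b)"
        using continuous_on_tendsto_compose[OF cont lim t] s A[OF t] by auto
    qed (use A[OF t] A[OF s] in auto)
    then have "\<exists>i. sse (A (s i)) (A t)"
      using A[OF t] assms(2)[OF t] assms(3) s t by (intro sse_frequently_limit) auto
    then show False using ns by blast
  qed
  have "sse (A 0) (A 1)"
  proof (rule connected_equivalence_relation[of "{0..1::real}" 0 1 "\<lambda>s t. sse (A s) (A t)"])
    fix t :: real assume t: "t \<in> {0..1}"
    obtain d where d: "d > 0" "\<And>s. s \<in> {0..1} \<Longrightarrow> \<bar>s - t\<bar> < d \<Longrightarrow> sse (A s) (A t)"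
      using local[OF t] by blast
    show "\<exists>T. openin (top_of_set {0..1}) T \<and> t \<in> T \<and> (\<forall>s\<in>T. sse (A t) (A s))"
    proof (intro exI[of _ "{0..1} \<inter> ball t d"] conjI ballI)
      show "openin (top_of_set {0..1}) ({0..1} \<inter> ball t d)" by (intro openin_open_Int open_ball)
    qed (use t d in \<open>auto simp: dist_real_def abs_minus_commute intro: sse_sym\<close>)
  qed (auto intro: sse_sym sse_trans)
  then show ?thesis
    by (rule sse_imp_strong_shift_equivalent_over) (use A[of 0] assms(2)[of 0] in \<open>auto intro: positive_imp_nonneg_matrix\<close>)
qed

end
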